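(* Let $A$ be a smooth real 1-form on $\mathbb{R}^{3+1}$ with $F=dA$, and let $Z\in\mathcal Z=\{T,\Omega_{12},\Omega_{23},\Omega_{31},S,K\}$. For every closed 2-form $G$ and every complex scalar field $f$ (on $\{r>0\}$), $$[r^2\,\mathbf{Div},\mathcal L_Z]G=0,$$ $$[r^2\Box_A,\widehat D_Z]f=2\sqrt{-1}\,r^2F_{\mu\nu}Z^\nu D^\mu f+\sqrt{-1}\,r^2\,\nabla^\mu\big(Z^\nu F_{\mu\nu}\big)f .$$
   Context: $\mathbb{R}^{3+1}$ carries the Minkowski metric $m=-dt^2+\sum_i (dx^i)^2$ with Levi-Civita connection $\nabla$; $r=|x|$, $u=\frac12(t-r)$, $v=\frac12(t+r)$, $L=\partial_t+\partial_r$, $\underline L=\partial_t-\partial_r$. Vector fields: $T=\partial_t$, $\Omega_{ij}=x_i\partial_j-x_j\partial_i$, $S=vL+u\underline L$, $K=v^2L+u^2\underline L$. $D_\mu=\partial_\mu+\sqrt{-1}A_\mu$, so $[D_\mu,D_\nu]=\sqrt{-1}F_{\mu\nu}$; $\Box_A=D^\mu D_\mu$; $\widehat D_Zf=D_Zf+\frac{Z(r)}{r}f=r^{-1}D_Z(rf)$. For a 2-form $G$, $\mathbf{Div}\,G$ is the 1-form $(\mathbf{Div}\,G)_\nu=\nabla^\mu G_{\mu\nu}$, and $\mathcal L_Z$ is the Lie derivative on forms. $[P,Q]=PQ-QP$; in the first identity $r^2\mathbf{Div}$ maps 2-forms to 1-forms and $\mathcal L_Z$ acts on both. *)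

theory Defs
  imports "HOL-Analysis.Analysis"
begin

text \<open>
  Tensor fields on Minkowski space are given by their components in the global Cartesian
  coordinates. The index type is \<open>4\<close>, with \<open>0\<close> (which equals \<open>4\<close> in this type) for time and
  \<open>1, 2, 3\<close> for space. Vector fields and 1-forms both have type
  \<open>spacetime \<Rightarrow> real^4\<close>; 2-forms have type \<open>spacetime \<Rightarrow> real^4^4\<close>, with \<open>G x $ \<mu> $ \<nu>\<close>
  the component with first index \<open>\<mu>\<close> and second index \<open>\<nu>\<close>.
\<close>

type_synonym spacetime = "real^4"

text \<open>Meant for open \<open>S\<close> only: the derivatives are taken at \<open>x\<close> in the full space.\<close>

primrec Ck_on ::
  "nat \<Rightarrow> 'a::real_normed_vector set \<Rightarrow> ('a \<Rightarrow> 'b::real_normed_vector) \<Rightarrow> bool" where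
  "Ck_on 0 S f \<longleftrightarrow> continuous_on S f"
| "Ck_on (Suc k) S f \<longleftrightarrow>
     (\<forall>x\<in>S. f differentiable (at x)) \<and> (\<forall>v. Ck_on k S (\<lambda>x. frechet_derivative f (at x) v))"

definition smooth_on ::
  "'a::real_normed_vector set \<Rightarrow> ('a \<Rightarrow> 'b::real_normed_vector) \<Rightarrow> bool" where
  "smooth_on S f \<longleftrightarrow> (\<forall>k. Ck_on k S f)"

definition partial :: "4 \<Rightarrow> (spacetime \<Rightarrow> 'b::real_normed_vector) \<Rightarrow> spacetime \<Rightarrow> 'b" where
  "partial \<mu> f x = frechet_derivative f (at x) (axis \<mu> 1)"

definition vderiv ::
  "(spacetime \<Rightarrow> real^4) \<Rightarrow> (spacetime \<Rightarrow> 'b::real_normed_vector) \<Rightarrow> spacetime \<Rightarrow> 'b" where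
  "vderiv Z f x = (\<Sum>\<mu>\<in>UNIV. Z x $ \<mu> *\<^sub>R partial \<mu> f x)"


subsection \<open>Minkowski metric and its Levi-Civita connection\<close>

definition minkowski :: "real^4^4" where
  "minkowski = (\<chi> \<mu> \<nu>. if \<mu> = \<nu> then (if \<mu> = 0 then -1 else 1) else 0)"

definition minkowski_inv :: "real^4^4" where
  "minkowski_inv = matrix_inv minkowski"

definition christoffel :: "(spacetime \<Rightarrow> real^4^4) \<Rightarrow> 4 \<Rightarrow> 4 \<Rightarrow> 4 \<Rightarrow> spacetime \<Rightarrow> real" where
  "christoffel g \<sigma> \<mu> \<nu> x =
     (\<Sum>\<rho>\<in>UNIV. matrix_inv (g x) $ \<sigma> $ \<rho> *
        (partial \<mu> (\<lambda>y. g y $ \<rho> $ \<nu>) x + partial \<nu> (\<lambda>y. g y $ \<rho> $ \<mu>) x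
         - partial \<rho> (\<lambda>y. g y $ \<mu> $ \<nu>) x)) / 2"

text \<open>
  \<open>nabla1 \<omega> \<rho> \<mu> = \<nabla>\<^sub>\<rho> \<omega>\<^sub>\<mu>\<close> and \<open>nabla2 G \<rho> \<mu> \<nu> = \<nabla>\<^sub>\<rho> G\<^sub>\<mu>\<^sub>\<nu>\<close>:
  the first index is the direction of differentiation.
\<close>

definition nabla1 :: "(spacetime \<Rightarrow> real^4) \<Rightarrow> 4 \<Rightarrow> 4 \<Rightarrow> spacetime \<Rightarrow> real" where
  "nabla1 \<omega> \<rho> \<mu> x =
     partial \<rho> (\<lambda>y. \<omega> y $ \<mu>) x
     - (\<Sum>\<sigma>\<in>UNIV. christoffel (\<lambda>_. minkowski) \<sigma> \<rho> \<mu> x * \<omega> x $ \<sigma>)"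

definition nabla2 :: "(spacetime \<Rightarrow> real^4^4) \<Rightarrow> 4 \<Rightarrow> 4 \<Rightarrow> 4 \<Rightarrow> spacetime \<Rightarrow> real" where
  "nabla2 G \<rho> \<mu> \<nu> x =
     partial \<rho> (\<lambda>y. G y $ \<mu> $ \<nu>) x
     - (\<Sum>\<sigma>\<in>UNIV. christoffel (\<lambda>_. minkowski) \<sigma> \<rho> \<mu> x * G x $ \<sigma> $ \<nu>)
     - (\<Sum>\<sigma>\<in>UNIV. christoffel (\<lambda>_. minkowski) \<sigma> \<rho> \<nu> x * G x $ \<mu> $ \<sigma>)"

definition div1 :: "(spacetime \<Rightarrow> real^4) \<Rightarrow> spacetime \<Rightarrow> real" where
  "div1 \<omega> x = (\<Sum>\<mu>\<in>UNIV. \<Sum>\<rho>\<in>UNIV. minkowski_inv $ \<mu> $ \<rho> * nabla1 \<omega> \<rho> \<mu> x)"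

definition Div :: "(spacetime \<Rightarrow> real^4^4) \<Rightarrow> spacetime \<Rightarrow> real^4" where
  "Div G x = (\<chi> \<nu>. \<Sum>\<mu>\<in>UNIV. \<Sum>\<rho>\<in>UNIV. minkowski_inv $ \<mu> $ \<rho> * nabla2 G \<rho> \<mu> \<nu> x)"


subsection \<open>Differential forms\<close>

definition two_form_on :: "spacetime set \<Rightarrow> (spacetime \<Rightarrow> real^4^4) \<Rightarrow> bool" where
  "two_form_on U G \<longleftrightarrow> smooth_on U G \<and> (\<forall>x\<in>U. \<forall>\<mu> \<nu>. G x $ \<mu> $ \<nu> = - G x $ \<nu> $ \<mu>)"

definition ext_d1 :: "(spacetime \<Rightarrow> real^4) \<Rightarrow> spacetime \<Rightarrow> real^4^4" where
  "ext_d1 A x = (\<chi> \<mu> \<nu>. partial \<mu> (\<lambda>y. A y $ \<nu>) x - partial \<nu> (\<lambda>y. A y $ \<mu>) x)"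

definition ext_d2 :: "(spacetime \<Rightarrow> real^4^4) \<Rightarrow> 4 \<Rightarrow> 4 \<Rightarrow> 4 \<Rightarrow> spacetime \<Rightarrow> real" where
  "ext_d2 G \<rho> \<mu> \<nu> x =
     partial \<rho> (\<lambda>y. G y $ \<mu> $ \<nu>) x + partial \<mu> (\<lambda>y. G y $ \<nu> $ \<rho>) x
     + partial \<nu> (\<lambda>y. G y $ \<rho> $ \<mu>) x"

definition closed_two_form_on :: "spacetime set \<Rightarrow> (spacetime \<Rightarrow> real^4^4) \<Rightarrow> bool" where
  "closed_two_form_on U G \<longleftrightarrow> two_form_on U G \<and> (\<forall>x\<in>U. \<forall>\<rho> \<mu> \<nu>. ext_d2 G \<rho> \<mu> \<nu> x = 0)"

text \<open>
  Components of the Lie derivative: \<open>(\<L>\<^sub>Z G)(X, Y) = Z (G(X, Y)) - G([Z, X], Y) - G(X, [Z, Y])\<close>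
  (and its analogue for 1-forms) evaluated on coordinate fields,
  where \<open>[Z, \<partial>\<^sub>\<mu>] = - (\<partial>\<^sub>\<mu> Z\<^sup>\<sigma>) \<partial>\<^sub>\<sigma>\<close>.
\<close>

definition Lie1 ::
  "(spacetime \<Rightarrow> real^4) \<Rightarrow> (spacetime \<Rightarrow> real^4) \<Rightarrow> spacetime \<Rightarrow> real^4" where
  "Lie1 Z \<omega> x =
     (\<chi> \<nu>. vderiv Z (\<lambda>y. \<omega> y $ \<nu>) x
        + (\<Sum>\<sigma>\<in>UNIV. partial \<nu> (\<lambda>y. Z y $ \<sigma>) x * \<omega> x $ \<sigma>))"

definition Lie2 ::
  "(spacetime \<Rightarrow> real^4) \<Rightarrow> (spacetime \<Rightarrow> real^4^4) \<Rightarrow> spacetime \<Rightarrow> real^4^4" where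
  "Lie2 Z G x =
     (\<chi> \<mu> \<nu>. vderiv Z (\<lambda>y. G y $ \<mu> $ \<nu>) x
        + (\<Sum>\<sigma>\<in>UNIV. partial \<mu> (\<lambda>y. Z y $ \<sigma>) x * G x $ \<sigma> $ \<nu>)
        + (\<Sum>\<sigma>\<in>UNIV. partial \<nu> (\<lambda>y. Z y $ \<sigma>) x * G x $ \<mu> $ \<sigma>))"


subsection \<open>Null coordinates and the commuting vector fields\<close>

definition rad :: "spacetime \<Rightarrow> real" where
  "rad x = sqrt ((x $ 1)\<^sup>2 + (x $ 2)\<^sup>2 + (x $ 3)\<^sup>2)"

definition off_axis :: "spacetime set" where
  "off_axis = {x. rad x > 0}"

definition null_u :: "spacetime \<Rightarrow> real" where
  "null_u x = (x $ 0 - rad x) / 2"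

definition null_v :: "spacetime \<Rightarrow> real" where
  "null_v x = (x $ 0 + rad x) / 2"

definition field_T :: "spacetime \<Rightarrow> real^4" where
  "field_T x = axis 0 1"

definition field_r :: "spacetime \<Rightarrow> real^4" where
  "field_r x = (\<chi> \<mu>. if \<mu> = 0 then 0 else x $ \<mu> / rad x)"

definition field_L :: "spacetime \<Rightarrow> real^4" where
  "field_L x = field_T x + field_r x"

definition field_Lbar :: "spacetime \<Rightarrow> real^4" where
  "field_Lbar x = field_T x - field_r x"

definition field_Omega :: "4 \<Rightarrow> 4 \<Rightarrow> spacetime \<Rightarrow> real^4" where
  "field_Omega i j x = x $ i *\<^sub>R axis j 1 - x $ j *\<^sub>R axis i 1"

definition field_S :: "spacetime \<Rightarrow> real^4" where
  "field_S x = null_v x *\<^sub>R field_L x + null_u x *\<^sub>R field_Lbar x"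

definition field_K :: "spacetime \<Rightarrow> real^4" where
  "field_K x = (null_v x)\<^sup>2 *\<^sub>R field_L x + (null_u x)\<^sup>2 *\<^sub>R field_Lbar x"

definition commuting_fields :: "(spacetime \<Rightarrow> real^4) set" where
  "commuting_fields =
     {field_T, field_Omega 1 2, field_Omega 2 3, field_Omega 3 1, field_S, field_K}"


subsection \<open>The gauge covariant derivative\<close>

definition covD ::
  "(spacetime \<Rightarrow> real^4) \<Rightarrow> 4 \<Rightarrow> (spacetime \<Rightarrow> complex) \<Rightarrow> spacetime \<Rightarrow> complex" where
  "covD A \<mu> f x = partial \<mu> f x + \<i> * of_real (A x $ \<mu>) * f x"

definition covD_up ::
  "(spacetime \<Rightarrow> real^4) \<Rightarrow> 4 \<Rightarrow> (spacetime \<Rightarrow> complex) \<Rightarrow> spacetime \<Rightarrow> complex" where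
  "covD_up A \<mu> f x = (\<Sum>\<rho>\<in>UNIV. of_real (minkowski_inv $ \<mu> $ \<rho>) * covD A \<rho> f x)"

definition covD_along ::
  "(spacetime \<Rightarrow> real^4) \<Rightarrow> (spacetime \<Rightarrow> real^4) \<Rightarrow> (spacetime \<Rightarrow> complex) \<Rightarrow> spacetime \<Rightarrow> complex"
  where
  "covD_along A Z f x = (\<Sum>\<mu>\<in>UNIV. of_real (Z x $ \<mu>) * covD A \<mu> f x)"

definition covBox ::
  "(spacetime \<Rightarrow> real^4) \<Rightarrow> (spacetime \<Rightarrow> complex) \<Rightarrow> spacetime \<Rightarrow> complex" where
  "covBox A f x = (\<Sum>\<mu>\<in>UNIV. covD_up A \<mu> (covD A \<mu> f) x)"

definition covD_hat ::
  "(spacetime \<Rightarrow> real^4) \<Rightarrow> (spacetime \<Rightarrow> real^4) \<Rightarrow> (spacetime \<Rightarrow> complex) \<Rightarrow> spacetime \<Rightarrow> complex"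
  where
  "covD_hat A Z f x = covD_along A Z f x + of_real (vderiv Z rad x / rad x) * f x"


subsection \<open>Commutators of operators on tensor fields\<close>

definition r2_times ::
  "('c \<Rightarrow> spacetime \<Rightarrow> 'b::real_vector) \<Rightarrow> 'c \<Rightarrow> spacetime \<Rightarrow> 'b" where
  "r2_times P w x = (rad x)\<^sup>2 *\<^sub>R P w x"

text \<open>
  \<open>[P, Q] w = P (Q w) - Q (P w)\<close>. When \<open>P\<close> changes the tensor type, as for
  2-forms to 1-forms, the operator \<open>Q\<close> acts on both types; its two instances are
  passed separately, \<open>Q\<close> on the source and \<open>Q'\<close> on the target of \<open>P\<close>.
\<close>

definition commutator ::
  "('c \<Rightarrow> spacetime \<Rightarrow> 'b::ab_group_add) \<Rightarrow> ('c \<Rightarrow> 'c) \<Rightarrow>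
   ((spacetime \<Rightarrow> 'b) \<Rightarrow> spacetime \<Rightarrow> 'b) \<Rightarrow> 'c \<Rightarrow> spacetime \<Rightarrow> 'b" where
  "commutator P Q Q' w x = P (Q w) x - Q' (P w) x"

end

theory Submission
  imports Defs
begin

text \<open>
  Each of the six fields \<open>Z\<close> is a conformal Killing field of Minkowski space,
  \<open>\<L>\<^sub>Z m = 2 \<lambda> m\<close>, with conformal factor \<open>\<lambda> = 0\<close> for \<open>T\<close> and the rotations, \<open>\<lambda> = 1\<close> for
  \<open>S\<close> and \<open>\<lambda> = t\<close> for \<open>K\<close>. Two further properties hold in all cases: \<open>Z(r) = \<lambda> r\<close> and
  \<open>\<box>\<lambda> = 0\<close>. The theorem follows from these facts.

  The divergence of 2-forms is conformally covariant in dimension 4, infinitesimally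
  \<open>Div (\<L>\<^sub>Z G) = \<L>\<^sub>Z (Div G) + 2 \<lambda> Div G\<close> (\<open>Div_Lie2\<close>). The weight \<open>r\<^sup>2\<close> absorbs the last term
  because \<open>Z(r\<^sup>2) = 2 \<lambda> r\<^sup>2\<close>, which gives the first identity.

  For the second identity, differentiating the conformal Killing equation determines all second
  derivatives of \<open>Z\<close> (\<open>second_derivative_Z\<close>), in particular \<open>\<box>Z\<^sup>\<nu> = - 2 \<partial>\<^sup>\<nu>\<lambda>\<close>. Together with
  \<open>[D\<^sub>\<mu>, D\<^sub>\<nu>] = \<i> F\<^sub>\<mu>\<^sub>\<nu>\<close> this shows (\<open>covBox_covD_along\<close>) that \<open>[\<box>\<^sub>A, D\<^sub>Z] f\<close> consists of the
  required curvature terms and of \<open>2 \<lambda> \<box>\<^sub>A f - 2 \<partial>\<^sup>\<nu>\<lambda> D\<^sub>\<nu>f\<close>. Since \<open>Z(r)/r = \<lambda>\<close>, the modified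
  derivative is \<open>D\<^sub>Z + \<lambda>\<close>; as \<open>\<box>\<lambda> = 0\<close>, its zeroth-order term contributes
  \<open>[\<box>\<^sub>A, \<lambda>] f = 2 \<partial>\<^sup>\<nu>\<lambda> D\<^sub>\<nu>f\<close> and removes the gradient of \<open>\<lambda>\<close>, while \<open>Z(r\<^sup>2)\<close> again absorbs
  \<open>2 \<lambda> \<box>\<^sub>A f\<close>.

  Both computations use that smooth functions on an open set form a ring closed under partial
  derivatives, and that second partial derivatives commute (\<open>second_derivative_symmetric\<close>).
\<close>

section \<open>Smooth functions and the symmetry of second derivatives\<close>

lemma Ck_on_Suc_D: "Ck_on (Suc k) S f \<Longrightarrow> Ck_on k S f"
proof (induction k arbitrary: f)
  case 0
  then show ?case
    by (auto intro!: continuous_at_imp_continuous_on differentiable_imp_continuous_within)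
next
  case (Suc k)
  show ?case using Suc.prems Suc.IH unfolding Ck_on.simps(2)[of "Suc k"] Ck_on.simps(2)[of k] by blast
qed

text \<open>
  \<open>Ck_on\<close> speaks of derivatives in the full space, so a modification of the function outside an
  open set does not matter. The differentiation rules below hold only on \<open>S\<close>; this lemma is what
  lets the inductions replace a derivative by its formula.
\<close>

lemma Ck_on_cong:
  assumes "open S" "\<And>x. x \<in> S \<Longrightarrow> f x = g x" "Ck_on k S f"
  shows "Ck_on k S g"
  using assms(2,3)
proof (induction k arbitrary: f g)
  case 0
  then show ?case by (metis Ck_on.simps(1) continuous_on_cong)
next
  case (Suc k)
  have "g differentiable (at x)" if "x \<in> S" for x
    using Suc.prems that assms(1)
    by (metis Ck_on.simps(2) differentiable_def has_derivative_transform_within_open)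
  moreover have "Ck_on k S (\<lambda>x. frechet_derivative g (at x) v)" for v
  proof (rule Suc.IH)
    show "Ck_on k S (\<lambda>x. frechet_derivative f (at x) v)" using Suc.prems(2) by simp
    show "frechet_derivative f (at x) v = frechet_derivative g (at x) v" if "x \<in> S" for x
      using frechet_derivative_transform_within_open[of f x S g] Suc.prems that assms(1) by auto
  qed
  ultimately show ?case by simp
qed

lemma Ck_on_SucI:
  assumes "open S" "\<And>x. x \<in> S \<Longrightarrow> (f has_derivative f' x) (at x)"
    and "\<And>v. Ck_on k S (\<lambda>x. f' x v)"
  shows "Ck_on (Suc k) S f"
proof -
  have "Ck_on k S (\<lambda>x. frechet_derivative f (at x) v)" for v
    by (rule Ck_on_cong[OF assms(1) _ assms(3)[of v]])
       (simp add: frechet_derivative_at[OF assms(2), symmetric])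
  then show ?thesis using assms(2) by (auto simp: differentiable_def)
qed

lemma Ck_on_SucD_deriv:
  assumes "Ck_on (Suc k) S f" "x \<in> S"
  shows "(f has_derivative frechet_derivative f (at x)) (at x)"
  using assms by (auto simp: frechet_derivative_works)

lemma Ck_on_const: "open S \<Longrightarrow> Ck_on k S (\<lambda>x. c)"
  by (induction k arbitrary: c) auto

lemma Ck_on_add:
  assumes "open S" "Ck_on k S f" "Ck_on k S g"
  shows "Ck_on k S (\<lambda>x. f x + g x)"
  using assms(2,3)
proof (induction k arbitrary: f g)
  case 0
  then show ?case by (auto intro: continuous_intros)
next
  case (Suc k)
  show ?case
  proof (rule Ck_on_SucI[OF assms(1)])
    show "((\<lambda>x. f x + g x) has_derivative
        (\<lambda>v. frechet_derivative f (at x) v + frechet_derivative g (at x) v)) (at x)"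
      if "x \<in> S" for x
      using Suc.prems that by (intro has_derivative_add Ck_on_SucD_deriv)
  qed (use Suc in simp)
qed

lemma (in bounded_linear) Ck_on_compose:
  assumes "open S" "Ck_on k S g"
  shows "Ck_on k S (\<lambda>x. f (g x))"
  using assms(2)
proof (induction k arbitrary: g)
  case 0
  then show ?case by (auto intro: continuous_on)
next
  case (Suc k)
  show ?case
  proof (rule Ck_on_SucI[OF assms(1)])
    show "((\<lambda>x. f (g x)) has_derivative (\<lambda>v. f (frechet_derivative g (at x) v))) (at x)"
      if "x \<in> S" for x
      using Suc.prems that by (intro has_derivative Ck_on_SucD_deriv)
  qed (use Suc in simp)
qed

lemma (in bounded_bilinear) Ck_on_compose:
  assumes "open S" "Ck_on k S f" "Ck_on k S g"
  shows "Ck_on k S (\<lambda>x. prod (f x) (g x))"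
  using assms(2,3)
proof (induction k arbitrary: f g)
  case 0
  then show ?case by (auto intro: continuous_on)
next
  case (Suc k)
  show ?case
  proof (rule Ck_on_SucI[OF assms(1)])
    show "((\<lambda>x. prod (f x) (g x)) has_derivative
        (\<lambda>v. prod (f x) (frechet_derivative g (at x) v) + prod (frechet_derivative f (at x) v) (g x))) (at x)"
      if "x \<in> S" for x
      using Suc.prems that by (intro FDERIV Ck_on_SucD_deriv)
    show "Ck_on k S (\<lambda>x. prod (f x) (frechet_derivative g (at x) v) + prod (frechet_derivative f (at x) v) (g x))"
      for v
      using Suc.prems Suc.prems[THEN Ck_on_Suc_D] by (intro Ck_on_add assms(1) Suc.IH) simp_all
  qed
qed

lemma smooth_on_differentiable:
  assumes "smooth_on S f" "x \<in> S"
  shows "(f has_derivative frechet_derivative f (at x)) (at x)"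
  using assms Ck_on_SucD_deriv[of 0 S f] by (auto simp: smooth_on_def simp del: Ck_on.simps)

lemma smooth_on_frechet_derivative:
  "smooth_on S f \<Longrightarrow> smooth_on S (\<lambda>x. frechet_derivative f (at x) v)"
  unfolding smooth_on_def by (metis Ck_on.simps(2))

lemma smooth_on_continuous: "smooth_on S f \<Longrightarrow> continuous_on S f"
  unfolding smooth_on_def by (metis Ck_on.simps(1))

lemma Ck_on_subset: "Ck_on k S f \<Longrightarrow> T \<subseteq> S \<Longrightarrow> Ck_on k T f"
  by (induction k arbitrary: f) (auto intro: continuous_on_subset)

lemma smooth_on_subset: "smooth_on S f \<Longrightarrow> T \<subseteq> S \<Longrightarrow> smooth_on T f"
  unfolding smooth_on_def by (blast intro: Ck_on_subset)

text \<open>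
  Restricting to lines reduces the symmetry of second derivatives to functions of one real
  variable.
\<close>

lemma has_derivative_along_line:
  fixes f :: "'a::real_normed_vector \<Rightarrow> 'b::real_normed_vector"
  assumes "(f has_derivative f') (at (x + a *\<^sub>R u))"
  shows "((\<lambda>a. f (x + a *\<^sub>R u)) has_derivative (\<lambda>h. h *\<^sub>R f' u)) (at a)"
proof -
  have "((\<lambda>a. x + a *\<^sub>R u) has_derivative (\<lambda>h. h *\<^sub>R u)) (at a)"
    by (auto intro!: derivative_eq_intros)
  from diff_chain_at[OF this assms] show ?thesis
    using linear_scale[OF has_derivative_linear[OF assms]] by (simp add: o_def)
qed

text \<open>
  The second difference over the parallelogram spanned by \<open>s u\<close> and \<open>s v\<close> is symmetric in \<open>u\<close> and
  \<open>v\<close>. Two applications of the mean value theorem, first along \<open>u\<close> and then along \<open>v\<close>, express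
  it by a mixed second derivative at a nearby point.
\<close>

lemma second_difference_mvt:
  fixes f :: "'a::real_normed_vector \<Rightarrow> real"
  assumes f: "smooth_on S f" and S: "\<And>a b. \<lbrakk>0 \<le> a; a \<le> s; 0 \<le> b; b \<le> s\<rbrakk> \<Longrightarrow> x + a *\<^sub>R u + b *\<^sub>R v \<in> S"
    and s: "0 < s"
  obtains a b where "0 \<le> a" "a \<le> s" "0 \<le> b" "b \<le> s"
    "f (x + s *\<^sub>R u + s *\<^sub>R v) - f (x + s *\<^sub>R u) - f (x + s *\<^sub>R v) + f x =
      s * s * frechet_derivative (\<lambda>y. frechet_derivative f (at y) u) (at (x + a *\<^sub>R u + b *\<^sub>R v)) v"
proof -
  let ?Du = "\<lambda>y. frechet_derivative f (at y) u"
  define p where "p a = f (x + s *\<^sub>R v + a *\<^sub>R u) - f (x + a *\<^sub>R u)" for a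
  have dp: "(p has_derivative (\<lambda>h. h * (?Du (x + s *\<^sub>R v + a *\<^sub>R u) - ?Du (x + a *\<^sub>R u)))) (at a)"
    if "0 \<le> a" "a \<le> s" for a
  proof -
    have "x + s *\<^sub>R v + a *\<^sub>R u \<in> S" "x + a *\<^sub>R u \<in> S"
      using S[of a s] S[of a 0] that s by (simp_all add: add_ac)
    then have "(p has_derivative (\<lambda>h. h *\<^sub>R ?Du (x + s *\<^sub>R v + a *\<^sub>R u) - h *\<^sub>R ?Du (x + a *\<^sub>R u))) (at a)"
      unfolding p_def
      by (intro has_derivative_diff has_derivative_along_line smooth_on_differentiable[OF f])
    then show ?thesis by (simp add: algebra_simps)
  qed
  obtain a where a: "a \<in> {0<..<s}"
    and pa: "p s - p 0 = (s - 0) * (?Du (x + s *\<^sub>R v + a *\<^sub>R u) - ?Du (x + a *\<^sub>R u))"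
    using mvt_simple[OF s, of p "\<lambda>a h. h * (?Du (x + s *\<^sub>R v + a *\<^sub>R u) - ?Du (x + a *\<^sub>R u))"]
      has_derivative_at_withinI[OF dp] by blast
  define q where "q b = ?Du (x + a *\<^sub>R u + b *\<^sub>R v)" for b
  have dq: "(q has_derivative (\<lambda>h. h * frechet_derivative ?Du (at (x + a *\<^sub>R u + b *\<^sub>R v)) v)) (at b)"
    if "0 \<le> b" "b \<le> s" for b
    unfolding q_def real_scaleR_def[symmetric] using that a S[of a b]
    by (intro has_derivative_along_line smooth_on_differentiable[OF smooth_on_frechet_derivative[OF f]])
      auto
  obtain b where b: "b \<in> {0<..<s}"
    and qb: "q s - q 0 = (s - 0) * frechet_derivative ?Du (at (x + a *\<^sub>R u + b *\<^sub>R v)) v"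
    using mvt_simple[OF s, of q "\<lambda>b h. h * frechet_derivative ?Du (at (x + a *\<^sub>R u + b *\<^sub>R v)) v"]
      has_derivative_at_withinI[OF dq] by blast
  show ?thesis
  proof (rule that[of a b])
    have "p s - p 0 = s * (q s - q 0)" using pa by (simp add: q_def add_ac)
    then show "f (x + s *\<^sub>R u + s *\<^sub>R v) - f (x + s *\<^sub>R u) - f (x + s *\<^sub>R v) + f x =
      s * s * frechet_derivative ?Du (at (x + a *\<^sub>R u + b *\<^sub>R v)) v"
      using qb by (simp add: p_def add_ac)
  qed (use a b in auto)
qed

text \<open>
  Both mixed derivatives at \<open>x\<close> are limits of the same second difference quotient, because they
  are continuous. If they differed, a parallelogram on which neither varies by half their distance
  would give a contradiction.
\<close>

lemma second_derivative_symmetric_real: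
  fixes f :: "'a::real_normed_vector \<Rightarrow> real"
  assumes f: "smooth_on S f" and "open S" "x \<in> S"
  shows "frechet_derivative (\<lambda>y. frechet_derivative f (at y) u) (at x) v =
         frechet_derivative (\<lambda>y. frechet_derivative f (at y) v) (at x) u"
proof (rule ccontr)
  define P where "P u v y = frechet_derivative (\<lambda>y. frechet_derivative f (at y) u) (at y) v" for u v y
  assume "\<not> ?thesis"
  then have "P u v x \<noteq> P v u x" by (simp add: P_def)
  define e where "e = dist (P u v x) (P v u x) / 2"
  have e: "e > 0" using \<open>P u v x \<noteq> P v u x\<close> by (simp add: e_def)
  have "continuous_on S (P u v)" for u v
    unfolding P_def by (intro smooth_on_continuous smooth_on_frechet_derivative f)
  then have "\<forall>\<^sub>F y in nhds x. dist (P u v y) (P u v x) < e" for u v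
    using tendstoD[OF _ e] assms(2,3)
    unfolding continuous_on_eq_continuous_at[OF assms(2)] continuous_at tendsto_at_iff_tendsto_nhds
    by blast
  then have "\<forall>\<^sub>F y in nhds x. y \<in> S \<and> dist (P u v y) (P u v x) < e \<and> dist (P v u y) (P v u x) < e"
    using eventually_nhds_in_open[OF assms(2,3)] by (simp add: eventually_conj_iff)
  then obtain d where d: "d > 0" and D: "\<And>y. dist y x < d \<Longrightarrow>
      y \<in> S \<and> dist (P u v y) (P u v x) < e \<and> dist (P v u y) (P v u x) < e"
    unfolding eventually_nhds_metric by blast
  (* A parallelogram of this side length stays within distance d of x; adding 1 avoids a division
     by zero when u and v both vanish. *)
  define s where "s = d / (2 * (norm u + norm v + 1))"
  have N: "norm u + norm v + 1 > 0" using norm_ge_zero[of u] norm_ge_zero[of v] by linarith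
  then have s: "s > 0" using d by (simp add: s_def)
  have near: "dist (x + a *\<^sub>R w + b *\<^sub>R z) x < d"
    if "0 \<le> a" "a \<le> s" "0 \<le> b" "b \<le> s" "norm w + norm z = norm u + norm v" for a b w z
  proof -
    have "norm (a *\<^sub>R w + b *\<^sub>R z) \<le> s * norm w + s * norm z"
      using norm_triangle_ineq[of "a *\<^sub>R w" "b *\<^sub>R z"] that
        mult_right_mono[of a s "norm w"] mult_right_mono[of b s "norm z"] by simp
    also have "\<dots> = s * (norm u + norm v)" using that(5) by (simp flip: distrib_left)
    also have "\<dots> < s * (2 * (norm u + norm v + 1))"
      using s N by (intro mult_strict_left_mono) simp_all
    also have "\<dots> = d" using N by (simp add: s_def field_simps)
    finally show ?thesis by (simp add: dist_norm add.assoc)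
  qed
  obtain a b where ab: "0 \<le> a" "a \<le> s" "0 \<le> b" "b \<le> s" and
    1: "f (x + s *\<^sub>R u + s *\<^sub>R v) - f (x + s *\<^sub>R u) - f (x + s *\<^sub>R v) + f x
       = s * s * P u v (x + a *\<^sub>R u + b *\<^sub>R v)"
    unfolding P_def
    by (rule second_difference_mvt[OF f _ s, of x u v]) (rule D[THEN conjunct1, OF near], auto)
  obtain a' b' where ab': "0 \<le> a'" "a' \<le> s" "0 \<le> b'" "b' \<le> s" and
    2: "f (x + s *\<^sub>R v + s *\<^sub>R u) - f (x + s *\<^sub>R v) - f (x + s *\<^sub>R u) + f x
       = s * s * P v u (x + a' *\<^sub>R v + b' *\<^sub>R u)"
    unfolding P_def
    by (rule second_difference_mvt[OF f _ s, of x v u]) (rule D[THEN conjunct1, OF near], auto)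
  have "P u v (x + a *\<^sub>R u + b *\<^sub>R v) = P v u (x + a' *\<^sub>R v + b' *\<^sub>R u)"
  proof -
    have "x + s *\<^sub>R v + s *\<^sub>R u = x + s *\<^sub>R u + s *\<^sub>R v" by simp
    then have "s * s * P u v (x + a *\<^sub>R u + b *\<^sub>R v) = s * s * P v u (x + a' *\<^sub>R v + b' *\<^sub>R u)"
      using 1 2 by (simp only:)
    then show ?thesis using s by simp
  qed
  moreover have "dist (P u v (x + a *\<^sub>R u + b *\<^sub>R v)) (P u v x) < e"
    using D[OF near[OF ab refl]] by simp
  moreover have "dist (P v u (x + a' *\<^sub>R v + b' *\<^sub>R u)) (P v u x) < e"
    using D[OF near[OF ab' add.commute]] by simp
  ultimately have "dist (P u v x) (P v u x) < 2 * e"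
    using dist_triangle_half_r[of _ "P u v x" "2 * e"] by simp
  then show False by (simp add: e_def)
qed

lemma (in bounded_linear) smooth_on_compose:
  "open S \<Longrightarrow> smooth_on S g \<Longrightarrow> smooth_on S (\<lambda>x. f (g x))"
  unfolding smooth_on_def by (simp add: Ck_on_compose)

lemma (in bounded_linear) frechet_derivative_compose:
  assumes "smooth_on S g" "x \<in> S"
  shows "frechet_derivative (\<lambda>x. f (g x)) (at x) v = f (frechet_derivative g (at x) v)"
  using fun_cong[OF frechet_derivative_at[OF has_derivative[OF smooth_on_differentiable[OF assms]]], of v]
  by simp

lemma frechet_derivative_cong:
  assumes "open S" "x \<in> S" "\<And>y. y \<in> S \<Longrightarrow> f y = g y" 
  shows "frechet_derivative f (at x) = frechet_derivative g (at x)"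
proof -
  have "(f has_derivative D) (at x) = (g has_derivative D) (at x)" for D
    using assms has_derivative_transform_within_open[of f D x UNIV S g]
      has_derivative_transform_within_open[of g D x UNIV S f] by auto
  then show ?thesis by (simp add: frechet_derivative_def)
qed

text \<open>
  The vector-valued case follows by pairing with an arbitrary vector \<open>w\<close>.
\<close>

lemma second_derivative_symmetric:
  fixes f :: "'a::real_normed_vector \<Rightarrow> 'b::real_inner"
  assumes f: "smooth_on S f" and "open S" "x \<in> S"
  shows "frechet_derivative (\<lambda>y. frechet_derivative f (at y) u) (at x) v =
         frechet_derivative (\<lambda>y. frechet_derivative f (at y) v) (at x) u"
proof (rule vector_eq_ldot[THEN iffD1, rule_format])
  fix w
  interpret w: bounded_linear "\<lambda>z::'b. w \<bullet> z" by (rule bounded_linear_inner_right)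
  have "w \<bullet> frechet_derivative (\<lambda>y. frechet_derivative f (at y) u) (at x) v
      = frechet_derivative (\<lambda>y. frechet_derivative (\<lambda>y. w \<bullet> f y) (at y) u) (at x) v" for u v
  proof -
    have "w \<bullet> frechet_derivative (\<lambda>y. frechet_derivative f (at y) u) (at x) v
        = frechet_derivative (\<lambda>y. w \<bullet> frechet_derivative f (at y) u) (at x) v"
      by (rule w.frechet_derivative_compose[OF smooth_on_frechet_derivative[OF f] assms(3), symmetric])
    also have "\<dots> = frechet_derivative (\<lambda>y. frechet_derivative (\<lambda>y. w \<bullet> f y) (at y) u) (at x) v"
      by (rule fun_cong[OF frechet_derivative_cong[OF assms(2,3)]])
        (rule w.frechet_derivative_compose[OF f, symmetric])
    finally show ?thesis .
  qed
  then show "w \<bullet> frechet_derivative (\<lambda>y. frechet_derivative f (at y) u) (at x) v =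
      w \<bullet> frechet_derivative (\<lambda>y. frechet_derivative f (at y) v) (at x) u"
    using second_derivative_symmetric_real[OF w.smooth_on_compose[OF assms(2) f] assms(2,3), of u v] by simp
qed

section \<open>Operators in Cartesian coordinates\<close>

definition metric_sign :: "4 \<Rightarrow> real" where
  "metric_sign \<mu> = (if \<mu> = 0 then -1 else 1)"

lemma metric_sign_square [simp]:
  "metric_sign \<mu> * metric_sign \<mu> = 1" "metric_sign \<mu> * (metric_sign \<mu> * c) = c"
  by (simp_all add: metric_sign_def)

lemma minkowski_component: "minkowski $ \<mu> $ \<nu> = (if \<mu> = \<nu> then metric_sign \<mu> else 0)"
  by (simp add: minkowski_def metric_sign_def)

lemma minkowski_inv_component: "minkowski_inv $ \<mu> $ \<nu> = (if \<mu> = \<nu> then metric_sign \<mu> else 0)"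
proof -
  have "minkowski ** minkowski = mat 1"
    by (simp add: vec_eq_iff matrix_matrix_mult_def minkowski_component mat_def forall_4 sum_4)
  then have "minkowski ** minkowski_inv = mat 1"
    unfolding minkowski_inv_def matrix_inv_def
    by (intro someI2[where a=minkowski and Q="\<lambda>B. minkowski ** B = mat 1"]) auto
  then have "minkowski_inv = minkowski"
    by (metis \<open>minkowski ** minkowski = mat 1\<close> matrix_mul_assoc matrix_mul_lid matrix_mul_rid)
  then show ?thesis by (simp add: minkowski_component)
qed

lemma partial_const [simp]: "partial \<mu> (\<lambda>y. c) x = 0"
  by (simp add: partial_def)

lemma partial_const_fun: "partial \<mu> (\<lambda>y. c) = (\<lambda>y. 0)"
  by (simp add: fun_eq_iff)

lemma christoffel_minkowski [simp]: "christoffel (\<lambda>_. minkowski) \<sigma> \<mu> \<nu> x = 0"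
  by (simp add: christoffel_def)

lemma sum_minkowski_inv:
  "(\<Sum>\<rho>\<in>UNIV. minkowski_inv $ \<mu> $ \<rho> * a \<rho>) = metric_sign \<mu> * a \<mu>"
  by (simp add: minkowski_inv_component if_distrib[of "\<lambda>c. c * _"] cong: if_cong)

lemma Div_component:
  "Div G x $ \<nu> = (\<Sum>\<mu>\<in>UNIV. metric_sign \<mu> * partial \<mu> (\<lambda>y. G y $ \<mu> $ \<nu>) x)"
  by (simp add: Div_def nabla2_def sum_minkowski_inv)

lemma div1_eq: "div1 \<omega> x = (\<Sum>\<mu>\<in>UNIV. metric_sign \<mu> * partial \<mu> (\<lambda>y. \<omega> y $ \<mu>) x)"
  by (simp add: div1_def nabla1_def sum_minkowski_inv)

lemma covD_up_eq: "covD_up A \<mu> f x = of_real (metric_sign \<mu>) * covD A \<mu> f x"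
  by (simp add: covD_up_def minkowski_inv_component if_distrib[of "\<lambda>c. complex_of_real c * _"] cong: if_cong)

lemma covBox_eq:
  "covBox A f x = (\<Sum>\<mu>\<in>UNIV. of_real (metric_sign \<mu>) * covD A \<mu> (covD A \<mu> f) x)"
  by (simp add: covBox_def covD_up_eq)

lemma Lie1_component:
  "Lie1 Z \<omega> x $ \<nu> = (\<Sum>\<sigma>\<in>UNIV. Z x $ \<sigma> * partial \<sigma> (\<lambda>y. \<omega> y $ \<nu>) x
      + partial \<nu> (\<lambda>y. Z y $ \<sigma>) x * \<omega> x $ \<sigma>)"
  by (simp add: Lie1_def vderiv_def sum.distrib)

lemma Lie2_component:
  "Lie2 Z G x $ \<mu> $ \<nu> = (\<Sum>\<sigma>\<in>UNIV. Z x $ \<sigma> * partial \<sigma> (\<lambda>y. G y $ \<mu> $ \<nu>) x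
      + partial \<mu> (\<lambda>y. Z y $ \<sigma>) x * G x $ \<sigma> $ \<nu>
      + partial \<nu> (\<lambda>y. Z y $ \<sigma>) x * G x $ \<mu> $ \<sigma>)"
  by (simp add: Lie2_def vderiv_def sum.distrib)

section \<open>Partial derivatives of smooth functions on an open region\<close>

locale open_region =
  fixes U :: "spacetime set"
  assumes open_region: "open U"
begin

lemma smooth_const: "smooth_on U (\<lambda>y. c)"
  by (simp add: smooth_on_def Ck_on_const open_region)

lemma smooth_add: "\<lbrakk>smooth_on U f; smooth_on U g\<rbrakk> \<Longrightarrow> smooth_on U (\<lambda>y. f y + g y)"
  by (simp add: smooth_on_def Ck_on_add open_region)

lemma smooth_sum: "(\<And>i. i \<in> I \<Longrightarrow> smooth_on U (f i)) \<Longrightarrow> smooth_on U (\<lambda>y. \<Sum>i\<in>I. f i y)"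
  by (induction I rule: infinite_finite_induct) (auto intro: smooth_const smooth_add)

lemma smooth_mult:
  fixes f g :: "spacetime \<Rightarrow> 'b::real_normed_algebra"
  shows "\<lbrakk>smooth_on U f; smooth_on U g\<rbrakk> \<Longrightarrow> smooth_on U (\<lambda>y. f y * g y)"
  unfolding smooth_on_def
  using bounded_bilinear.Ck_on_compose[OF bounded_bilinear_mult open_region] by blast

lemma smooth_of_real:
  "smooth_on U g \<Longrightarrow> smooth_on U (\<lambda>y. of_real (g y) :: 'b::{real_normed_algebra_1,real_inner})"
  by (rule bounded_linear.smooth_on_compose[OF bounded_linear_of_real open_region])

lemma smooth_component: "smooth_on U w \<Longrightarrow> smooth_on U (\<lambda>y. w y $ i)"
  by (rule bounded_linear.smooth_on_compose[OF bounded_linear_vec_nth open_region])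

lemma smooth_partial: "smooth_on U f \<Longrightarrow> smooth_on U (partial \<mu> f)"
  unfolding partial_def by (rule smooth_on_frechet_derivative)

lemma smooth_diff:
  "\<lbrakk>smooth_on U f; smooth_on U g\<rbrakk> \<Longrightarrow> smooth_on U (\<lambda>y. f y - g y)"
  using smooth_add[OF _ bounded_linear.smooth_on_compose[OF bounded_linear_minus[OF bounded_linear_ident] open_region]]
  by fastforce

lemma smooth_divide_const:
  fixes f :: "spacetime \<Rightarrow> real"
  shows "smooth_on U f \<Longrightarrow> smooth_on U (\<lambda>y. f y / c)"
  unfolding divide_inverse by (intro smooth_mult smooth_const)

lemmas smooth_intros =
  smooth_divide_const smooth_const smooth_add smooth_diff smooth_sum smooth_mult smooth_of_real
  smooth_component smooth_partial

lemma partial_eqI: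
  "(f has_derivative f') (at x) \<Longrightarrow> partial \<mu> f x = f' (axis \<mu> 1)"
  unfolding partial_def using frechet_derivative_at by metis

lemma partial_cong:
  "\<lbrakk>x \<in> U; \<And>y. y \<in> U \<Longrightarrow> f y = g y\<rbrakk> \<Longrightarrow> partial \<mu> f x = partial \<mu> g x"
  unfolding partial_def using frechet_derivative_cong[OF open_region] by metis

lemma partial_commute:
  fixes f :: "spacetime \<Rightarrow> 'b::real_inner"
  shows "\<lbrakk>smooth_on U f; x \<in> U\<rbrakk> \<Longrightarrow> partial \<mu> (partial \<nu> f) x = partial \<nu> (partial \<mu> f) x"
  unfolding partial_def by (rule second_derivative_symmetric[OF _ open_region])

lemma partial_add:
  assumes "smooth_on U f" "smooth_on U g" "x \<in> U"
  shows "partial \<mu> (\<lambda>y. f y + g y) x = partial \<mu> f x + partial \<mu> g x"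
  unfolding partial_def
  using fun_cong[OF frechet_derivative_at[OF has_derivative_add[
      OF assms(1,2)[THEN smooth_on_differentiable, OF assms(3)]]], of "axis \<mu> 1"]
  by simp

lemma partial_diff:
  assumes "smooth_on U f" "smooth_on U g" "x \<in> U"
  shows "partial \<mu> (\<lambda>y. f y - g y) x = partial \<mu> f x - partial \<mu> g x"
  unfolding partial_def
  using fun_cong[OF frechet_derivative_at[OF has_derivative_diff[
      OF assms(1,2)[THEN smooth_on_differentiable, OF assms(3)]]], of "axis \<mu> 1"]
  by simp

lemma partial_mult:
  fixes f g :: "spacetime \<Rightarrow> 'b::real_normed_algebra"
  assumes "smooth_on U f" "smooth_on U g" "x \<in> U"
  shows "partial \<mu> (\<lambda>y. f y * g y) x = f x * partial \<mu> g x + partial \<mu> f x * g x"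
  unfolding partial_def
  using fun_cong[OF frechet_derivative_at[OF has_derivative_mult[
      OF assms(1,2)[THEN smooth_on_differentiable, OF assms(3)]]], of "axis \<mu> 1"]
  by simp

lemma partial_of_real:
  assumes "smooth_on U g" "x \<in> U"
  shows "partial \<mu> (\<lambda>y. of_real (g y) :: 'b::{real_normed_algebra_1,real_inner}) x = of_real (partial \<mu> g x)"
  unfolding partial_def
  by (rule bounded_linear.frechet_derivative_compose[OF bounded_linear_of_real assms])

lemma partial_sum:
  assumes "\<And>i. i \<in> I \<Longrightarrow> smooth_on U (f i)" "x \<in> U"
  shows "partial \<mu> (\<lambda>y. \<Sum>i\<in>I. f i y) x = (\<Sum>i\<in>I. partial \<mu> (f i) x)"
  using assms(1)
proof (induction I rule: infinite_finite_induct)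
  case (insert i I)
  then show ?case by (simp add: partial_add smooth_sum assms(2))
qed simp_all

lemma partial_divide_const:
  fixes f :: "spacetime \<Rightarrow> real"
  shows "\<lbrakk>smooth_on U f; x \<in> U\<rbrakk> \<Longrightarrow> partial \<mu> (\<lambda>y. f y / c) x = partial \<mu> f x / c"
  unfolding divide_inverse by (simp add: partial_mult smooth_const)

lemmas partial_rules =
  partial_divide_const partial_add partial_diff partial_mult partial_of_real partial_sum

end

section \<open>Conformal Killing fields of Minkowski space\<close>

text \<open>
  \<open>\<L>\<^sub>Z m = 2 \<lambda> m\<close>, written with both indices raised, that is
  \<open>\<partial>\<^sup>\<mu>Z\<^sup>\<nu> + \<partial>\<^sup>\<nu>Z\<^sup>\<mu> = 2 \<lambda> m\<^sup>\<mu>\<^sup>\<nu>\<close>: in this form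
  only the components \<open>Z\<^sup>\<nu>\<close> occur, and the equation can be contracted directly with lower indices.
\<close>

locale conformal_killing = open_region U for U +
  fixes Z :: "spacetime \<Rightarrow> real^4" and lam :: "spacetime \<Rightarrow> real"
  assumes smooth_Z: "smooth_on U (\<lambda>y. Z y $ \<nu>)"
    and smooth_lam: "smooth_on U lam"
    and killing: "y \<in> U \<Longrightarrow>
      metric_sign \<mu> * partial \<mu> (\<lambda>y. Z y $ \<nu>) y + metric_sign \<nu> * partial \<nu> (\<lambda>y. Z y $ \<mu>) y
      = (if \<mu> = \<nu> then 2 * metric_sign \<mu> * lam y else 0)"
begin

lemma killing_derivative:
  assumes "x \<in> U"
  shows "metric_sign \<mu> * partial \<alpha> (partial \<mu> (\<lambda>y. Z y $ \<nu>)) x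
      + metric_sign \<nu> * partial \<alpha> (partial \<nu> (\<lambda>y. Z y $ \<mu>)) x
      = (if \<mu> = \<nu> then 2 * metric_sign \<mu> * partial \<alpha> lam x else 0)"
proof -
  have "partial \<alpha> (\<lambda>y. metric_sign \<mu> * partial \<mu> (\<lambda>y. Z y $ \<nu>) y
        + metric_sign \<nu> * partial \<nu> (\<lambda>y. Z y $ \<mu>) y) x
      = partial \<alpha> (\<lambda>y. if \<mu> = \<nu> then 2 * metric_sign \<mu> * lam y else 0) x"
    by (rule partial_cong[OF assms killing])
  then show ?thesis
    by (cases "\<mu> = \<nu>") (simp_all add: partial_rules smooth_intros smooth_Z smooth_lam assms)
qed

text \<open>
  The formula \<open>\<partial>\<^sub>\<alpha>\<partial>\<^sub>\<mu>Z\<^sub>\<nu> = m\<^sub>\<mu>\<^sub>\<nu> \<partial>\<^sub>\<alpha>\<lambda>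
  + m\<^sub>\<alpha>\<^sub>\<nu> \<partial>\<^sub>\<mu>\<lambda> - m\<^sub>\<alpha>\<^sub>\<mu> \<partial>\<^sub>\<nu>\<lambda>\<close>, again with raised indices. It is obtained
  exactly like the Christoffel symbols: \<open>\<partial>\<^sub>\<alpha>\<partial>\<^sub>\<mu>Z\<^sub>\<nu>\<close> is symmetric in \<open>\<alpha>, \<mu>\<close>, and its part
  symmetric in \<open>\<mu>, \<nu>\<close> is known, so an alternating sum over the cyclic permutations isolates it.
\<close>

lemma second_derivative_Z:
  assumes "x \<in> U"
  shows "metric_sign \<alpha> * metric_sign \<mu> * partial \<alpha> (partial \<mu> (\<lambda>y. Z y $ \<nu>)) x
    = (if \<mu> = \<nu> then metric_sign \<mu> * (metric_sign \<alpha> * partial \<alpha> lam x) else 0)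
    + (if \<alpha> = \<nu> then metric_sign \<alpha> * (metric_sign \<mu> * partial \<mu> lam x) else 0)
    - (if \<alpha> = \<mu> then metric_sign \<alpha> * (metric_sign \<nu> * partial \<nu> lam x) else 0)"
proof -
  define P where "P \<alpha> \<mu> \<nu> =
    metric_sign \<alpha> * metric_sign \<mu> * partial \<alpha> (partial \<mu> (\<lambda>y. Z y $ \<nu>)) x" for \<alpha> \<mu> \<nu>
  define l where "l \<alpha> = metric_sign \<alpha> * partial \<alpha> lam x" for \<alpha>
  have comm: "P \<alpha> \<mu> \<nu> = P \<mu> \<alpha> \<nu>" for \<alpha> \<mu> \<nu>
    using partial_commute[OF smooth_Z assms] by (simp add: P_def)
  have skew: "P \<alpha> \<mu> \<nu> + P \<alpha> \<nu> \<mu> = (if \<mu> = \<nu> then 2 * metric_sign \<mu> * l \<alpha> else 0)" for \<alpha> \<mu> \<nu>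
    using arg_cong[OF killing_derivative[OF assms, of \<mu> \<alpha> \<nu>], of "\<lambda>c. metric_sign \<alpha> * c"]
    by (auto simp: P_def l_def distrib_left mult_ac)
  have "2 * P \<alpha> \<mu> \<nu> = (P \<alpha> \<mu> \<nu> + P \<alpha> \<nu> \<mu>) + (P \<mu> \<alpha> \<nu> + P \<mu> \<nu> \<alpha>) - (P \<nu> \<alpha> \<mu> + P \<nu> \<mu> \<alpha>)"
    using comm[of \<alpha> \<mu> \<nu>] comm[of \<alpha> \<nu> \<mu>] comm[of \<mu> \<nu> \<alpha>] by linarith
  then have "P \<alpha> \<mu> \<nu> = (if \<mu> = \<nu> then metric_sign \<mu> * l \<alpha> else 0)
      + (if \<alpha> = \<nu> then metric_sign \<alpha> * l \<mu> else 0) - (if \<alpha> = \<mu> then metric_sign \<alpha> * l \<nu> else 0)"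
    unfolding skew by auto
  then show ?thesis by (simp add: P_def l_def)
qed

text \<open>
  \<open>\<box>Z\<^sub>\<nu> = (2 - n) \<partial>\<^sub>\<nu>\<lambda>\<close> in dimension \<open>n = 4\<close>: the factor \<open>-2\<close> is where the dimension enters.
\<close>

lemma trace_second_derivative_Z:
  assumes "x \<in> U"
  shows "(\<Sum>\<mu>\<in>UNIV. metric_sign \<mu> * partial \<mu> (partial \<mu> (\<lambda>y. Z y $ \<nu>)) x)
    = - 2 * metric_sign \<nu> * partial \<nu> lam x"
proof -
  have "metric_sign \<mu> * partial \<mu> (partial \<mu> (\<lambda>y. Z y $ \<nu>)) x
      = (if \<mu> = \<nu> then 2 * metric_sign \<nu> * partial \<nu> lam x else 0) - metric_sign \<nu> * partial \<nu> lam x" for \<mu>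
    using arg_cong[OF second_derivative_Z[OF assms, of \<mu> \<mu> \<nu>], of "\<lambda>c. metric_sign \<mu> * c"]
    by (auto simp: algebra_simps)
  then show ?thesis by (simp add: sum_subtractf)
qed

text \<open>
  The other second-order contraction of \<open>Z\<close> in the divergence of a Lie derivative. The term with
  \<open>m\<^sub>\<mu>\<^sub>\<sigma>\<close> dies against the antisymmetric \<open>G\<close>; the remaining two agree and give the factor 2 that
  offsets the factor \<open>-2\<close> of \<open>trace_second_derivative_Z\<close>.
\<close>

lemma skew_second_derivative_Z:
  assumes x: "x \<in> U" and G: "\<And>\<mu> \<nu>. G \<mu> \<nu> = - G \<nu> \<mu>"
  shows "(\<Sum>\<mu>\<in>UNIV. \<Sum>\<sigma>\<in>UNIV. metric_sign \<mu> * partial \<mu> (partial \<nu> (\<lambda>y. Z y $ \<sigma>)) x * G \<mu> \<sigma>)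
    = 2 * (\<Sum>\<sigma>\<in>UNIV. metric_sign \<sigma> * partial \<sigma> lam x * G \<sigma> \<nu>)"
proof -
  have G0: "G \<mu> \<mu> = 0" for \<mu> using G[of \<mu> \<mu>] by simp
  have summand: "metric_sign \<mu> * partial \<mu> (partial \<nu> (\<lambda>y. Z y $ \<sigma>)) x * G \<mu> \<sigma>
      = (if \<nu> = \<sigma> then metric_sign \<mu> * partial \<mu> lam x * G \<mu> \<sigma> else 0)
        + (if \<mu> = \<nu> then metric_sign \<sigma> * partial \<sigma> lam x * G \<sigma> \<mu> else 0)" for \<mu> \<sigma>
    using arg_cong[OF second_derivative_Z[OF x, of \<mu> \<nu> \<sigma>], of "\<lambda>c. metric_sign \<nu> * c * G \<mu> \<sigma>"] G0 G[of \<mu> \<sigma>]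
    by (auto simp: algebra_simps split: if_splits)
  show ?thesis
    unfolding summand sum.distrib
    by (subst (2) sum.swap) simp
qed

text \<open>
  The divergence of 2-forms is conformally covariant in dimension 4. In
  \<open>\<nabla>\<^sup>\<mu>(\<L>\<^sub>Z G)\<^sub>\<mu>\<^sub>\<nu>\<close> the terms in which \<open>Z\<close> is not differentiated, or only in the direction
  \<open>\<nu>\<close>, form \<open>(\<L>\<^sub>Z Div G)\<^sub>\<nu>\<close>; the terms with one contracted derivative on each of \<open>Z\<close> and \<open>G\<close>
  combine by the conformal Killing equation to \<open>2 \<lambda> Div G\<close>; those with two derivatives on \<open>Z\<close>
  cancel.
\<close>

lemma Div_Lie2:
  assumes smooth_G: "\<And>\<mu> \<nu>. smooth_on U (\<lambda>y. G y $ \<mu> $ \<nu>)"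
    and skew: "\<And>\<mu> \<nu>. G x $ \<mu> $ \<nu> = - G x $ \<nu> $ \<mu>" and x: "x \<in> U"
  shows "Div (Lie2 Z G) x = Lie1 Z (Div G) x + (2 * lam x) *\<^sub>R Div G x"
proof (rule vec_eq_iff[THEN iffD2, rule_format])
  fix \<nu>
  let ?e = metric_sign
  define a where "a \<mu> \<sigma> = partial \<mu> (\<lambda>y. Z y $ \<sigma>) x" for \<mu> \<sigma>
  define b where "b \<alpha> \<mu> \<sigma> = partial \<alpha> (partial \<mu> (\<lambda>y. Z y $ \<sigma>)) x" for \<alpha> \<mu> \<sigma>
  define g where "g \<mu> \<sigma> = G x $ \<mu> $ \<sigma>" for \<mu> \<sigma>
  define dg where "dg \<rho> \<mu> \<sigma> = partial \<rho> (\<lambda>y. G y $ \<mu> $ \<sigma>) x" for \<rho> \<mu> \<sigma>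
  define ddg where "ddg \<alpha> \<rho> \<mu> \<sigma> = partial \<alpha> (partial \<rho> (\<lambda>y. G y $ \<mu> $ \<sigma>)) x" for \<alpha> \<rho> \<mu> \<sigma>
  have g_skew: "g \<mu> \<sigma> = - g \<sigma> \<mu>" for \<mu> \<sigma>
    unfolding g_def by (rule skew)
  note rules = partial_rules smooth_intros smooth_G smooth_Z x
  have DivG: "Div G x $ \<sigma> = (\<Sum>\<mu>\<in>UNIV. ?e \<mu> * dg \<mu> \<mu> \<sigma>)" for \<sigma>
    by (simp add: Div_component dg_def)
  have "Div (Lie2 Z G) x $ \<nu> = (\<Sum>\<mu>\<in>UNIV. \<Sum>\<sigma>\<in>UNIV.
      ?e \<mu> * a \<mu> \<sigma> * dg \<sigma> \<mu> \<nu> + ?e \<mu> * (Z x $ \<sigma> * ddg \<mu> \<sigma> \<mu> \<nu>) + ?e \<mu> * b \<mu> \<mu> \<sigma> * g \<sigma> \<nu>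
      + ?e \<mu> * a \<mu> \<sigma> * dg \<mu> \<sigma> \<nu> + ?e \<mu> * b \<mu> \<nu> \<sigma> * g \<mu> \<sigma> + ?e \<mu> * (a \<nu> \<sigma> * dg \<mu> \<mu> \<sigma>))"
    by (simp add: Div_component Lie2_component rules sum_distrib_left a_def b_def g_def dg_def ddg_def
        algebra_simps)
  also have "\<dots> = (\<Sum>\<mu>\<in>UNIV. \<Sum>\<sigma>\<in>UNIV. ?e \<mu> * a \<mu> \<sigma> * dg \<sigma> \<mu> \<nu>)
      + (\<Sum>\<mu>\<in>UNIV. \<Sum>\<sigma>\<in>UNIV. ?e \<mu> * (Z x $ \<sigma> * ddg \<mu> \<sigma> \<mu> \<nu>))
      + (\<Sum>\<mu>\<in>UNIV. \<Sum>\<sigma>\<in>UNIV. ?e \<mu> * b \<mu> \<mu> \<sigma> * g \<sigma> \<nu>)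
      + (\<Sum>\<mu>\<in>UNIV. \<Sum>\<sigma>\<in>UNIV. ?e \<mu> * a \<mu> \<sigma> * dg \<mu> \<sigma> \<nu>)
      + (\<Sum>\<mu>\<in>UNIV. \<Sum>\<sigma>\<in>UNIV. ?e \<mu> * b \<mu> \<nu> \<sigma> * g \<mu> \<sigma>)
      + (\<Sum>\<mu>\<in>UNIV. \<Sum>\<sigma>\<in>UNIV. ?e \<mu> * (a \<nu> \<sigma> * dg \<mu> \<mu> \<sigma>))"
    (is "_ = ?T1 + ?T2 + ?T3 + ?T4 + ?T5 + ?T6") by (simp only: sum.distrib)
  also have "?T2 = (\<Sum>\<sigma>\<in>UNIV. Z x $ \<sigma> * partial \<sigma> (\<lambda>y. Div G y $ \<nu>) x)"
    by (subst sum.swap) (simp add: Div_component rules ddg_def partial_commute[OF smooth_G x] sum_distrib_left mult_ac)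
  also have "?T6 = (\<Sum>\<sigma>\<in>UNIV. a \<nu> \<sigma> * Div G x $ \<sigma>)"
    by (subst sum.swap) (simp add: DivG sum_distrib_left mult_ac)
  also have "?T3 = (\<Sum>\<sigma>\<in>UNIV. (\<Sum>\<mu>\<in>UNIV. ?e \<mu> * b \<mu> \<mu> \<sigma>) * g \<sigma> \<nu>)"
    by (subst sum.swap) (simp add: sum_distrib_right)
  also have "\<dots> = - ?T5"
    using skew_second_derivative_Z[where G=g and \<nu>=\<nu>, OF x g_skew]
    by (simp add: b_def g_def trace_second_derivative_Z[OF x] sum_distrib_left sum_negf mult_ac)
  also have "?T1 = (\<Sum>\<mu>\<in>UNIV. \<Sum>\<sigma>\<in>UNIV. (?e \<sigma> * a \<sigma> \<mu>) * dg \<mu> \<sigma> \<nu>)"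
    by (rule sum.swap)
  also have "\<dots> = (\<Sum>\<mu>\<in>UNIV. \<Sum>\<sigma>\<in>UNIV. (if \<mu> = \<sigma> then 2 * ?e \<mu> * lam x else 0) * dg \<mu> \<sigma> \<nu>) - ?T4"
    unfolding killing[OF x, symmetric] by (simp add: a_def sum_subtractf[symmetric] algebra_simps)
  also have "(\<Sum>\<mu>\<in>UNIV. \<Sum>\<sigma>\<in>UNIV. (if \<mu> = \<sigma> then 2 * ?e \<mu> * lam x else 0) * dg \<mu> \<sigma> \<nu>)
      = 2 * lam x * Div G x $ \<nu>"
    by (simp add: DivG sum_distrib_left mult_ac if_distrib[of "\<lambda>c. _ * c"] cong: if_cong)
  finally show "Div (Lie2 Z G) x $ \<nu> = (Lie1 Z (Div G) x + (2 * lam x) *\<^sub>R Div G x) $ \<nu>"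
    by (simp add: Lie1_component a_def sum.distrib)
qed

end

section \<open>The gauge covariant wave operator\<close>

locale gauge_potential = open_region U for U +
  fixes A :: "spacetime \<Rightarrow> real^4"
  assumes smooth_A: "smooth_on U (\<lambda>y. A y $ \<nu>)"
begin

lemma smooth_covD: "smooth_on U f \<Longrightarrow> smooth_on U (covD A \<mu> f)"
  unfolding covD_def by (intro smooth_intros smooth_A)

lemma smooth_covD_along:
  "\<lbrakk>\<And>\<nu>. smooth_on U (\<lambda>y. Z y $ \<nu>); smooth_on U f\<rbrakk> \<Longrightarrow> smooth_on U (covD_along A Z f)"
  unfolding covD_along_def by (intro smooth_sum smooth_mult smooth_of_real smooth_covD)

lemma smooth_curvature: "smooth_on U (\<lambda>y. ext_d1 A y $ \<mu> $ \<nu>)"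
  by (simp add: ext_d1_def smooth_intros smooth_A)

lemma covD_cong: "\<lbrakk>x \<in> U; \<And>y. y \<in> U \<Longrightarrow> f y = g y\<rbrakk> \<Longrightarrow> covD A \<mu> f x = covD A \<mu> g x"
  unfolding covD_def using partial_cong[of x f g] by simp

lemma covD_add:
  "\<lbrakk>smooth_on U f; smooth_on U g; x \<in> U\<rbrakk>
    \<Longrightarrow> covD A \<mu> (\<lambda>y. f y + g y) x = covD A \<mu> f x + covD A \<mu> g x"
  by (simp add: covD_def partial_rules algebra_simps)

lemma covD_sum:
  "\<lbrakk>\<And>i. i \<in> I \<Longrightarrow> smooth_on U (f i); x \<in> U\<rbrakk>
    \<Longrightarrow> covD A \<mu> (\<lambda>y. \<Sum>i\<in>I. f i y) x = (\<Sum>i\<in>I. covD A \<mu> (f i) x)"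
  by (simp add: covD_def partial_rules sum.distrib sum_distrib_left)

lemma covD_real_mult:
  "\<lbrakk>smooth_on U g; smooth_on U f; x \<in> U\<rbrakk>
    \<Longrightarrow> covD A \<mu> (\<lambda>y. of_real (g y) * f y) x
      = of_real (partial \<mu> g x) * f x + of_real (g x) * covD A \<mu> f x"
  by (simp add: covD_def partial_rules smooth_intros algebra_simps)

lemma covD_const_mult:
  "\<lbrakk>smooth_on U f; x \<in> U\<rbrakk> \<Longrightarrow> covD A \<mu> (\<lambda>y. c * f y) x = c * covD A \<mu> f x"
  by (simp add: covD_def partial_rules smooth_intros algebra_simps)

lemmas covD_rules = covD_add covD_sum covD_real_mult covD_const_mult

text \<open>
  The curvature identity \<open>[D\<^sub>\<mu>, D\<^sub>\<nu>] = \<i> F\<^sub>\<mu>\<^sub>\<nu>\<close>; the ordinary second derivatives drop out by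
  their symmetry.
\<close>

lemma covD_commute:
  assumes "smooth_on U f" "x \<in> U"
  shows "covD A \<mu> (covD A \<nu> f) x
    = covD A \<nu> (covD A \<mu> f) x + \<i> * of_real (ext_d1 A x $ \<mu> $ \<nu>) * f x"
proof -
  have expand: "covD A \<mu> (covD A \<nu> f) x = partial \<mu> (partial \<nu> f) x
      + \<i> * of_real (partial \<mu> (\<lambda>y. A y $ \<nu>) x) * f x
      + \<i> * of_real (A x $ \<nu>) * partial \<mu> f x
      + \<i> * of_real (A x $ \<mu>) * (partial \<nu> f x + \<i> * of_real (A x $ \<nu>) * f x)" for \<mu> \<nu>
    unfolding covD_def by (simp add: partial_rules smooth_intros smooth_A assms algebra_simps)
  show ?thesis
    unfolding expand[of \<mu> \<nu>] expand[of \<nu> \<mu>]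
    using partial_commute[OF assms, of \<mu> \<nu>] by (simp add: ext_d1_def algebra_simps)
qed

text \<open>
  Moving \<open>D\<^sub>\<nu>\<close> to the front past two equal derivatives costs two curvature terms; the first is
  itself differentiated once, which produces \<open>\<partial>\<^sub>\<mu>F\<^sub>\<mu>\<^sub>\<nu>\<close> and makes the coefficient of
  \<open>D\<^sub>\<mu>f\<close> a 2.
\<close>

lemma covD_twice_covD:
  assumes f: "smooth_on U f" and x: "x \<in> U"
  shows "covD A \<mu> (covD A \<mu> (covD A \<nu> f)) x = covD A \<nu> (covD A \<mu> (covD A \<mu> f)) x
    + 2 * \<i> * of_real (ext_d1 A x $ \<mu> $ \<nu>) * covD A \<mu> f x
    + \<i> * of_real (partial \<mu> (\<lambda>y. ext_d1 A y $ \<mu> $ \<nu>) x) * f x"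
proof -
  have "covD A \<mu> (covD A \<mu> (covD A \<nu> f)) x
      = covD A \<mu> (\<lambda>y. covD A \<nu> (covD A \<mu> f) y + \<i> * (of_real (ext_d1 A y $ \<mu> $ \<nu>) * f y)) x"
    by (rule covD_cong[OF x]) (simp add: covD_commute[OF f, of _ \<mu> \<nu>] mult.assoc)
  also have "\<dots> = covD A \<mu> (covD A \<nu> (covD A \<mu> f)) x
      + \<i> * (of_real (partial \<mu> (\<lambda>y. ext_d1 A y $ \<mu> $ \<nu>) x) * f x
        + of_real (ext_d1 A x $ \<mu> $ \<nu>) * covD A \<mu> f x)"
    by (simp add: covD_rules smooth_covD smooth_intros smooth_curvature f x)
  also have "covD A \<mu> (covD A \<nu> (covD A \<mu> f)) x = covD A \<nu> (covD A \<mu> (covD A \<mu> f)) x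
      + \<i> * of_real (ext_d1 A x $ \<mu> $ \<nu>) * covD A \<mu> f x"
    by (rule covD_commute[OF smooth_covD[OF f] x])
  finally show ?thesis by (simp add: algebra_simps)
qed

lemma covBox_add:
  "\<lbrakk>smooth_on U f; smooth_on U g; x \<in> U\<rbrakk>
    \<Longrightarrow> covBox A (\<lambda>y. f y + g y) x = covBox A f x + covBox A g x"
proof -
  assume *: "smooth_on U f" "smooth_on U g" "x \<in> U"
  have "covD A \<mu> (covD A \<mu> (\<lambda>y. f y + g y)) x = covD A \<mu> (\<lambda>y. covD A \<mu> f y + covD A \<mu> g y) x" for \<mu>
    by (rule covD_cong) (simp_all add: covD_add *)
  then show ?thesis
    by (simp add: covBox_eq covD_add smooth_covD * distrib_left sum.distrib)
qed

lemma covBox_cong: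
  assumes x: "x \<in> U" and eq: "\<And>y. y \<in> U \<Longrightarrow> f y = g y"
  shows "covBox A f x = covBox A g x"
proof -
  have "covD A \<mu> (covD A \<mu> f) x = covD A \<mu> (covD A \<mu> g) x" for \<mu>
    by (intro covD_cong x eq)
  then show ?thesis by (simp add: covBox_eq)
qed

lemma covBox_real_mult:
  assumes g: "smooth_on U g" and f: "smooth_on U f" and x: "x \<in> U"
  shows "covBox A (\<lambda>y. of_real (g y) * f y) x
    = of_real (\<Sum>\<mu>\<in>UNIV. metric_sign \<mu> * partial \<mu> (partial \<mu> g) x) * f x
      + 2 * (\<Sum>\<mu>\<in>UNIV. of_real (metric_sign \<mu> * partial \<mu> g x) * covD A \<mu> f x)
      + of_real (g x) * covBox A f x"
proof -
  have "covD A \<mu> (covD A \<mu> (\<lambda>y. of_real (g y) * f y)) x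
      = covD A \<mu> (\<lambda>y. of_real (partial \<mu> g y) * f y + of_real (g y) * covD A \<mu> f y) x" for \<mu>
    by (rule covD_cong[OF x]) (simp add: covD_rules f g)
  also have "\<dots> \<mu> = of_real (partial \<mu> (partial \<mu> g) x) * f x
      + 2 * of_real (partial \<mu> g x) * covD A \<mu> f x + of_real (g x) * covD A \<mu> (covD A \<mu> f) x" for \<mu>
    by (simp add: covD_rules smooth_covD smooth_intros f g x)
  finally show ?thesis
    by (simp add: covBox_eq sum.distrib sum_distrib_left sum_distrib_right algebra_simps)
qed

end

locale conformal_killing_gauge = conformal_killing U Z lam + gauge_potential U A for U Z lam A
begin

text \<open>
  Split \<open>\<partial>\<^sup>\<mu>Z\<^sup>\<nu>\<close> into its symmetric part, which is \<open>\<lambda> m\<^sup>\<mu>\<^sup>\<nu>\<close> and yields the wave operator, and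
  its antisymmetric part, which sees \<open>D\<^sub>\<mu>D\<^sub>\<nu>\<close> only through the curvature.
\<close>

lemma contracted_second_covD:
  assumes f: "smooth_on U f" and x: "x \<in> U"
  shows "2 * (\<Sum>\<mu>\<in>UNIV. \<Sum>\<nu>\<in>UNIV.
      of_real (metric_sign \<mu> * partial \<mu> (\<lambda>y. Z y $ \<nu>) x) * covD A \<mu> (covD A \<nu> f) x)
    = 2 * of_real (lam x) * covBox A f x
      + \<i> * of_real (\<Sum>\<mu>\<in>UNIV. \<Sum>\<nu>\<in>UNIV.
          metric_sign \<mu> * partial \<mu> (\<lambda>y. Z y $ \<nu>) x * ext_d1 A x $ \<mu> $ \<nu>) * f x"
proof -
  define W where "W \<mu> \<nu> = complex_of_real (metric_sign \<mu> * partial \<mu> (\<lambda>y. Z y $ \<nu>) x)" for \<mu> \<nu>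
  define X where "X \<mu> \<nu> = covD A \<mu> (covD A \<nu> f) x" for \<mu> \<nu>
  have W: "W \<mu> \<nu> + W \<nu> \<mu> = (if \<mu> = \<nu> then 2 * of_real (metric_sign \<mu> * lam x) else 0)" for \<mu> \<nu>
    unfolding W_def of_real_add[symmetric] killing[OF x] by simp
  have X: "X \<mu> \<nu> = X \<nu> \<mu> + \<i> * of_real (ext_d1 A x $ \<mu> $ \<nu>) * f x" for \<mu> \<nu>
    unfolding X_def by (rule covD_commute[OF f x])
  have "2 * (\<Sum>\<mu>\<in>UNIV. \<Sum>\<nu>\<in>UNIV. W \<mu> \<nu> * X \<mu> \<nu>)
      = (\<Sum>\<mu>\<in>UNIV. \<Sum>\<nu>\<in>UNIV. W \<mu> \<nu> * X \<mu> \<nu>) + (\<Sum>\<nu>\<in>UNIV. \<Sum>\<mu>\<in>UNIV. W \<mu> \<nu> * X \<mu> \<nu>)"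
    using sum.swap[of "\<lambda>\<mu> \<nu>. W \<mu> \<nu> * X \<mu> \<nu>" UNIV UNIV] by simp
  also have "\<dots> = (\<Sum>\<mu>\<in>UNIV. \<Sum>\<nu>\<in>UNIV. (W \<mu> \<nu> + W \<nu> \<mu>) * X \<nu> \<mu>
      + W \<mu> \<nu> * (\<i> * of_real (ext_d1 A x $ \<mu> $ \<nu>) * f x))"
    unfolding sum.distrib[symmetric] by (intro sum.cong refl, subst X) (simp add: algebra_simps)
  also have "\<dots> = (\<Sum>\<mu>\<in>UNIV. 2 * of_real (metric_sign \<mu> * lam x) * X \<mu> \<mu>)
      + (\<Sum>\<mu>\<in>UNIV. \<Sum>\<nu>\<in>UNIV. W \<mu> \<nu> * (\<i> * of_real (ext_d1 A x $ \<mu> $ \<nu>) * f x))"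
    unfolding sum.distrib W by (simp add: if_distrib[of "\<lambda>c. c * _"] cong: if_cong)
  finally show ?thesis
    by (simp add: W_def X_def covBox_eq sum_distrib_left sum_distrib_right mult_ac)
qed

text \<open>
  By the Leibniz rule \<open>D\<^sup>\<mu>D\<^sub>\<mu>(Z\<^sup>\<nu>D\<^sub>\<nu>f)\<close> has a term with \<open>\<box>Z\<close>, a term with
  \<open>\<partial>\<^sup>\<mu>Z\<^sup>\<nu>D\<^sub>\<mu>D\<^sub>\<nu>f\<close> and a term with \<open>D\<^sup>\<mu>D\<^sub>\<mu>D\<^sub>\<nu>f\<close>. The undifferentiated multiple of \<open>f\<close> is the
  divergence \<open>\<nabla>\<^sup>\<mu>(Z\<^sup>\<nu>F\<^sub>\<mu>\<^sub>\<nu>)\<close>: its part with \<open>\<partial>\<^sup>\<mu>Z\<^sup>\<nu>\<close> comes from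
  \<open>contracted_second_covD\<close>, its part with \<open>\<nabla>\<^sup>\<mu>F\<^sub>\<mu>\<^sub>\<nu>\<close> from \<open>covD_twice_covD\<close>.
\<close>

lemma covBox_covD_along:
  assumes f: "smooth_on U f" and x: "x \<in> U"
  shows "covBox A (covD_along A Z f) x = covD_along A Z (covBox A f) x
    + 2 * of_real (lam x) * covBox A f x
    - 2 * (\<Sum>\<nu>\<in>UNIV. of_real (metric_sign \<nu> * partial \<nu> lam x) * covD A \<nu> f x)
    + 2 * \<i> * (\<Sum>\<mu>\<in>UNIV. \<Sum>\<nu>\<in>UNIV. of_real (ext_d1 A x $ \<mu> $ \<nu> * Z x $ \<nu>) * covD_up A \<mu> f x)
    + \<i> * of_real (div1 (\<lambda>y. \<chi> \<mu>. \<Sum>\<nu>\<in>UNIV. Z y $ \<nu> * ext_d1 A y $ \<mu> $ \<nu>) x) * f x"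
proof -
  let ?e = metric_sign
  let ?F = "\<lambda>\<mu> \<nu>. ext_d1 A x $ \<mu> $ \<nu>"
  let ?dF = "\<lambda>\<mu> \<nu>. partial \<mu> (\<lambda>y. ext_d1 A y $ \<mu> $ \<nu>) x"
  let ?a = "\<lambda>\<mu> \<nu>. partial \<mu> (\<lambda>y. Z y $ \<nu>) x"
  let ?b = "\<lambda>\<mu> \<nu>. partial \<mu> (partial \<mu> (\<lambda>y. Z y $ \<nu>)) x"
  note smooth = smooth_intros smooth_covD smooth_covD_along smooth_curvature smooth_Z f
  have "covD A \<mu> (covD A \<mu> (covD_along A Z f)) x
      = covD A \<mu> (\<lambda>y. \<Sum>\<nu>\<in>UNIV. of_real (partial \<mu> (\<lambda>y. Z y $ \<nu>) y) * covD A \<nu> f y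
          + of_real (Z y $ \<nu>) * covD A \<mu> (covD A \<nu> f) y) x" for \<mu>
    by (rule covD_cong[OF x]) (simp add: covD_along_def[abs_def] covD_rules smooth)
  also have "\<dots> \<mu> = (\<Sum>\<nu>\<in>UNIV. of_real (?b \<mu> \<nu>) * covD A \<nu> f x
      + 2 * of_real (?a \<mu> \<nu>) * covD A \<mu> (covD A \<nu> f) x
      + of_real (Z x $ \<nu>) * covD A \<mu> (covD A \<mu> (covD A \<nu> f)) x)" for \<mu>
    by (simp add: covD_rules smooth x) (simp add: algebra_simps)
  finally have "covBox A (covD_along A Z f) x = (\<Sum>\<mu>\<in>UNIV. \<Sum>\<nu>\<in>UNIV.
        of_real (?e \<mu> * ?b \<mu> \<nu>) * covD A \<nu> f x
      + 2 * (of_real (?e \<mu> * ?a \<mu> \<nu>) * covD A \<mu> (covD A \<nu> f) x)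
      + of_real (?e \<mu>) * (of_real (Z x $ \<nu>) * covD A \<nu> (covD A \<mu> (covD A \<mu> f)) x)
      + 2 * \<i> * (of_real (?F \<mu> \<nu> * Z x $ \<nu>) * (of_real (?e \<mu>) * covD A \<mu> f x))
      + \<i> * of_real (?e \<mu> * (Z x $ \<nu> * ?dF \<mu> \<nu>)) * f x)"
    by (simp add: covBox_eq covD_twice_covD[OF f x] sum_distrib_left algebra_simps)
  also have "\<dots> = (\<Sum>\<mu>\<in>UNIV. \<Sum>\<nu>\<in>UNIV. of_real (?e \<mu> * ?b \<mu> \<nu>) * covD A \<nu> f x)
      + 2 * (\<Sum>\<mu>\<in>UNIV. \<Sum>\<nu>\<in>UNIV. of_real (?e \<mu> * ?a \<mu> \<nu>) * covD A \<mu> (covD A \<nu> f) x)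
      + (\<Sum>\<mu>\<in>UNIV. \<Sum>\<nu>\<in>UNIV. of_real (?e \<mu>) * (of_real (Z x $ \<nu>) * covD A \<nu> (covD A \<mu> (covD A \<mu> f)) x))
      + 2 * \<i> * (\<Sum>\<mu>\<in>UNIV. \<Sum>\<nu>\<in>UNIV. of_real (?F \<mu> \<nu> * Z x $ \<nu>) * covD_up A \<mu> f x)
      + \<i> * of_real (\<Sum>\<mu>\<in>UNIV. \<Sum>\<nu>\<in>UNIV. ?e \<mu> * (Z x $ \<nu> * ?dF \<mu> \<nu>)) * f x"
    (is "_ = ?T1 + ?T2 + ?T3 + ?T4 + ?T5")
    unfolding sum.distrib by (simp add: sum_distrib_left sum_distrib_right covD_up_eq)
  also have "?T1 = (\<Sum>\<nu>\<in>UNIV. of_real (\<Sum>\<mu>\<in>UNIV. ?e \<mu> * ?b \<mu> \<nu>) * covD A \<nu> f x)"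
    by (subst sum.swap) (simp add: sum_distrib_right)
  also have "\<dots> = - 2 * (\<Sum>\<nu>\<in>UNIV. of_real (?e \<nu> * partial \<nu> lam x) * covD A \<nu> f x)"
    by (simp add: trace_second_derivative_Z[OF x] sum_distrib_left sum_negf mult_ac)
  also have "?T3 = covD_along A Z (covBox A f) x"
    by (subst sum.swap)
      (simp add: covD_along_def covBox_eq[abs_def] covD_rules smooth x sum_distrib_left mult_ac)
  also note contracted_second_covD[OF f x]
  also have "div1 (\<lambda>y. \<chi> \<mu>. \<Sum>\<nu>\<in>UNIV. Z y $ \<nu> * ext_d1 A y $ \<mu> $ \<nu>) x
      = (\<Sum>\<mu>\<in>UNIV. \<Sum>\<nu>\<in>UNIV. ?e \<mu> * ?a \<mu> \<nu> * ?F \<mu> \<nu>)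
        + (\<Sum>\<mu>\<in>UNIV. \<Sum>\<nu>\<in>UNIV. ?e \<mu> * (Z x $ \<nu> * ?dF \<mu> \<nu>))"
    by (simp add: div1_eq partial_rules smooth x sum_distrib_left sum.distrib distrib_left mult_ac)
  ultimately show ?thesis by (simp add: algebra_simps)
qed

end

section \<open>The six commuting vector fields\<close>

lemma continuous_on_rad: "continuous_on S rad"
  unfolding rad_def by (intro continuous_intros)

lemma open_off_axis: "open off_axis"
  unfolding off_axis_def by (intro open_Collect_less continuous_on_rad continuous_intros)

lemma rad_square: "(rad x)\<^sup>2 = (x $ 1)\<^sup>2 + (x $ 2)\<^sup>2 + (x $ 3)\<^sup>2"
  by (simp add: rad_def)

interpretation off_axis: open_region off_axis
  by unfold_locales (rule open_off_axis)

text \<open>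
  In the index type, sums over all values run through \<open>4\<close>, which is the time index \<open>0\<close>.
\<close>

lemma index4_zero: "(4::4) = 0"
  by simp

lemma sum_spacetime: "(\<Sum>\<mu>\<in>UNIV. f \<mu>) = f 0 + f 1 + f 2 + f (3::4)"
  by (simp add: sum_4 index4_zero add_ac)

lemma partial_coordinate: "partial \<mu> (\<lambda>y. y $ \<nu>) x = (if \<mu> = \<nu> then 1 else 0)"
proof -
  have "((\<lambda>y::spacetime. y $ \<nu>) has_derivative (\<lambda>h. h $ \<nu>)) (at x)"
    by (intro bounded_linear_imp_has_derivative bounded_linear_vec_nth)
  from fun_cong[OF frechet_derivative_at[OF this], of "axis \<mu> 1"] show ?thesis
    unfolding partial_def by (auto simp: axis_def)
qed

lemma rad_has_derivative:
  assumes "x \<in> off_axis"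
  shows "(rad has_derivative (\<lambda>h. (x $ 1 * h $ 1 + x $ 2 * h $ 2 + x $ 3 * h $ 3) / rad x)) (at x)"
proof -
  have "(x $ 1)\<^sup>2 + (x $ 2)\<^sup>2 + (x $ 3)\<^sup>2 > 0"
    using assms by (simp add: off_axis_def rad_def)
  then show ?thesis
    unfolding rad_def[abs_def]
    by (auto intro!: derivative_eq_intros bounded_linear.has_derivative[OF bounded_linear_vec_nth] simp: field_simps)
qed

lemma partial_rad:
  assumes "x \<in> off_axis"
  shows "partial \<mu> rad x = (if \<mu> = 0 then 0 else x $ \<mu> / rad x)"
  unfolding off_axis.partial_eqI[OF rad_has_derivative[OF assms]]
  by (cases \<mu> rule: exhaust_4[THEN disjE]) (auto simp: axis_def)

lemma vderiv_rad:
  assumes "x \<in> off_axis"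
  shows "vderiv Z rad x = (Z x $ 1 * x $ 1 + Z x $ 2 * x $ 2 + Z x $ 3 * x $ 3) / rad x"
  by (simp add: vderiv_def partial_rad[OF assms] sum_spacetime add_divide_distrib)

text \<open>
  What the six vector fields have in common. The condition on \<open>rad\<close> ties the weight \<open>r\<^sup>2\<close> to the
  conformal factor: \<open>Z(r\<^sup>2) = 2 \<lambda> r\<^sup>2\<close>, and the zeroth-order term \<open>Z(r)/r\<close> of \<open>covD_hat\<close> is \<open>\<lambda>\<close>.
\<close>

locale commuting_field = conformal_killing off_axis Z lam for Z lam +
  assumes wave_lam: "x \<in> off_axis \<Longrightarrow> (\<Sum>\<mu>\<in>UNIV. metric_sign \<mu> * partial \<mu> (partial \<mu> lam) x) = 0"
    and vderiv_rad_eq: "x \<in> off_axis \<Longrightarrow> vderiv Z rad x = lam x * rad x"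

lemma smooth_coordinate: "smooth_on off_axis (\<lambda>y. y $ \<nu>)"
  by (rule off_axis.smooth_component)
    (auto simp: smooth_on_def intro!: Ck_on_SucI[OF open_off_axis has_derivative_ident, THEN Ck_on_Suc_D]
      Ck_on_const open_off_axis)

lemmas coordinate_rules =
  off_axis.partial_rules off_axis.smooth_intros smooth_coordinate partial_coordinate

text \<open>
  The null coordinates hide that \<open>S = t \<partial>\<^sub>t + r \<partial>\<^sub>r\<close> is the position field. The equation also
  holds on the axis, where \<open>field_r\<close> vanishes.
\<close>

lemma field_S_eq: "field_S x = x"
proof -
  have "field_S x = x $ 0 *\<^sub>R field_T x + rad x *\<^sub>R field_r x"
    unfolding field_S_def field_L_def field_Lbar_def null_u_def null_v_def
    by (simp add: vec_eq_iff field_simps)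
  moreover have "x $ \<mu> = 0" if "rad x = 0" "\<mu> \<noteq> 0" for \<mu>
    using that exhaust_4[of \<mu>] rad_square[of x] by (auto simp: add_nonneg_eq_0_iff)
  ultimately show ?thesis
    by (auto simp: vec_eq_iff field_T_def field_r_def axis_def)
qed

text \<open>
  From \<open>u\<^sup>2 + v\<^sup>2 = (t\<^sup>2 + r\<^sup>2)/2\<close> and \<open>v\<^sup>2 - u\<^sup>2 = t r\<close> one gets
  \<open>K = (t\<^sup>2 + r\<^sup>2)/2 \<partial>\<^sub>t + t r \<partial>\<^sub>r\<close>, so the components are quadratic polynomials. Separating
  \<open>t x\<^sup>\<mu>\<close>, as here, exhibits \<open>t\<close> as the conformal factor: the gradient of \<open>t\<close> in this term and
  the derivative of the remaining one together contribute an antisymmetric matrix to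
  \<open>\<partial>\<^sup>\<mu>K\<^sup>\<nu>\<close>.
\<close>

lemma field_K_component:
  "field_K x $ \<mu> = x $ 0 * x $ \<mu>
    + (if \<mu> = 0 then (x $ 1 * x $ 1 + x $ 2 * x $ 2 + x $ 3 * x $ 3 - x $ 0 * x $ 0) / 2 else 0)"
proof -
  have "field_K x = (((x $ 0)\<^sup>2 + (rad x)\<^sup>2) / 2) *\<^sub>R field_T x + (x $ 0 * rad x) *\<^sub>R field_r x"
    unfolding field_K_def field_L_def field_Lbar_def null_u_def null_v_def
    by (simp add: vec_eq_iff field_simps power2_eq_square)
  moreover have "x $ \<mu> = 0" if "rad x = 0" "\<mu> \<noteq> 0"
    using that exhaust_4[of \<mu>] rad_square[of x] by (auto simp: add_nonneg_eq_0_iff)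
  ultimately show ?thesis
    by (auto simp: field_T_def field_r_def axis_def rad_square) (simp_all add: field_simps power2_eq_square)
qed

lemma commuting_field_T: "commuting_field field_T (\<lambda>_. 0)"
  by unfold_locales
    (simp_all add: field_T_def open_off_axis coordinate_rules vderiv_rad axis_def partial_const_fun)

lemma commuting_field_Omega:
  assumes "i \<noteq> 0" "j \<noteq> 0" "i \<noteq> j"
  shows "commuting_field (field_Omega i j) (\<lambda>_. 0)"
proof unfold_locales
  have Z: "field_Omega i j x $ \<nu> = x $ i * axis j 1 $ \<nu> - x $ j * axis i 1 $ \<nu>" for x \<nu>
    by (simp add: field_Omega_def)
  show "smooth_on off_axis (\<lambda>y. field_Omega i j y $ \<nu>)" for \<nu>
    unfolding Z by (simp add: coordinate_rules)
  show "metric_sign \<mu> * partial \<mu> (\<lambda>y. field_Omega i j y $ \<nu>) y +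
        metric_sign \<nu> * partial \<nu> (\<lambda>y. field_Omega i j y $ \<mu>) y =
        (if \<mu> = \<nu> then 2 * metric_sign \<mu> * 0 else 0)" if "y \<in> off_axis" for y \<mu> \<nu>
    unfolding Z using that assms by (auto simp: coordinate_rules axis_def metric_sign_def)
  have "(\<Sum>\<mu>\<in>{1,2,3}. field_Omega i j x $ \<mu> * x $ \<mu>) = 0" for x
    using assms exhaust_4[of i] exhaust_4[of j] unfolding Z by (auto simp: axis_def)
  then show "vderiv (field_Omega i j) rad x = 0 * rad x" if "x \<in> off_axis" for x
    using that by (simp add: vderiv_rad add.assoc)
qed (simp_all add: open_off_axis coordinate_rules partial_const_fun)

lemma commuting_field_S: "commuting_field field_S (\<lambda>_. 1)"
proof unfold_locales
  show "vderiv field_S rad x = 1 * rad x" if "x \<in> off_axis" for x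
    using that rad_square[of x] by (simp add: vderiv_rad field_S_eq off_axis_def field_simps power2_eq_square)
qed (auto simp add: open_off_axis coordinate_rules field_S_eq[abs_def] partial_const_fun)

lemma commuting_field_K: "commuting_field field_K (\<lambda>x. x $ 0)"
proof unfold_locales
  show "smooth_on off_axis (\<lambda>y. field_K y $ \<nu>)" for \<nu>
    unfolding field_K_component
    by (cases "\<nu> = 0") (simp_all add: coordinate_rules)
  have dK: "metric_sign \<mu> * partial \<mu> (\<lambda>y. field_K y $ \<nu>) y
      = (if \<mu> = \<nu> then metric_sign \<mu> * y $ 0 else 0)
        + (if \<nu> = 0 then y $ \<mu> else 0) - (if \<mu> = 0 then y $ \<nu> else 0)"
    if "y \<in> off_axis" for y \<mu> \<nu>
    using that exhaust_4[of \<mu>] unfolding field_K_component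
    by (cases "\<nu> = 0") (auto simp: coordinate_rules metric_sign_def field_simps)
  show "metric_sign \<mu> * partial \<mu> (\<lambda>y. field_K y $ \<nu>) y +
        metric_sign \<nu> * partial \<nu> (\<lambda>y. field_K y $ \<mu>) y =
        (if \<mu> = \<nu> then 2 * metric_sign \<mu> * y $ 0 else 0)" if "y \<in> off_axis" for y \<mu> \<nu>
    unfolding dK[OF that] by simp
  show "vderiv field_K rad x = x $ 0 * rad x" if "x \<in> off_axis" for x
  proof -
    have "field_K x $ 1 * x $ 1 + field_K x $ 2 * x $ 2 + field_K x $ 3 * x $ 3 = x $ 0 * (rad x)\<^sup>2"
      unfolding rad_square by (simp add: field_K_component power2_eq_square algebra_simps)
    then have "vderiv field_K rad x = x $ 0 * (rad x)\<^sup>2 / rad x"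
      using that by (simp add: vderiv_rad)
    then show ?thesis using that by (simp add: off_axis_def power2_eq_square)
  qed
  show "(\<Sum>\<mu>\<in>UNIV. metric_sign \<mu> * partial \<mu> (partial \<mu> (\<lambda>x. x $ 0)) x) = 0" for x
    by (simp add: partial_coordinate[abs_def])
qed (simp_all add: open_off_axis coordinate_rules)

lemma commuting_fields_commuting:
  assumes "Z \<in> commuting_fields"
  obtains lam where "commuting_field Z lam"
  using assms commuting_field_T commuting_field_S commuting_field_K
    commuting_field_Omega[of 1 2] commuting_field_Omega[of 2 3] commuting_field_Omega[of 3 1]
  unfolding commuting_fields_def by auto

section \<open>The commutator identities\<close>

context commuting_field
begin

lemma vderiv_rad_square:
  assumes "x \<in> off_axis"
  shows "(\<Sum>\<mu>\<in>UNIV. Z x $ \<mu> * partial \<mu> (\<lambda>y. (rad y)\<^sup>2) x) = 2 * lam x * (rad x)\<^sup>2"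
proof -
  have "partial \<mu> (\<lambda>y. (rad y)\<^sup>2) x = 2 * rad x * partial \<mu> rad x" for \<mu>
    unfolding off_axis.partial_eqI[OF has_derivative_power[OF rad_has_derivative[OF assms], of 2]]
      off_axis.partial_eqI[OF rad_has_derivative[OF assms]] by simp
  then have "(\<Sum>\<mu>\<in>UNIV. Z x $ \<mu> * partial \<mu> (\<lambda>y. (rad y)\<^sup>2) x) = 2 * rad x * vderiv Z rad x"
    by (simp add: vderiv_def sum_distrib_left mult_ac)
  then show ?thesis
    by (simp add: vderiv_rad_eq[OF assms] power2_eq_square)
qed

lemma smooth_rad_square: "smooth_on off_axis (\<lambda>y. (rad y)\<^sup>2)"
  unfolding rad_square unfolding power2_eq_square
  by (intro off_axis.smooth_add off_axis.smooth_mult smooth_coordinate)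

lemma covD_hat_eq: "y \<in> off_axis \<Longrightarrow> covD_hat A Z f y = covD_along A Z f y + of_real (lam y) * f y"
  using vderiv_rad_eq[of y] by (simp add: covD_hat_def off_axis_def)

text \<open>
  The two sources of \<open>2 \<lambda> r\<^sup>2 Div G\<close> cancel: the conformal weight of the divergence
  (\<open>Div_Lie2\<close>) and \<open>Z(r\<^sup>2) = 2 \<lambda> r\<^sup>2\<close>.
\<close>

lemma commutator_Div_Lie:
  assumes G: "two_form_on off_axis G" and x: "x \<in> off_axis"
  shows "commutator (r2_times Div) (Lie2 Z) (Lie1 Z) G x = 0"
proof -
  have sG: "smooth_on off_axis (\<lambda>y. G y $ \<mu> $ \<nu>)" for \<mu> \<nu>
    using G unfolding two_form_on_def by (intro off_axis.smooth_component) blast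
  have skew: "G x $ \<mu> $ \<nu> = - G x $ \<nu> $ \<mu>" for \<mu> \<nu>
    using G x unfolding two_form_on_def by blast
  have sD: "smooth_on off_axis (\<lambda>y. Div G y $ \<nu>)" for \<nu>
    unfolding Div_component
    by (intro off_axis.smooth_sum off_axis.smooth_mult off_axis.smooth_const
        off_axis.smooth_partial sG)
  have "Lie1 Z (r2_times Div G) x $ \<nu> = (rad x)\<^sup>2 * Lie1 Z (Div G) x $ \<nu>
      + (\<Sum>\<sigma>\<in>UNIV. Z x $ \<sigma> * partial \<sigma> (\<lambda>y. (rad y)\<^sup>2) x) * Div G x $ \<nu>" for \<nu>
    by (simp add: Lie1_component r2_times_def off_axis.partial_mult[OF smooth_rad_square sD x])
      (simp add: sum.distrib sum_distrib_left sum_distrib_right algebra_simps)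
  then show ?thesis
    unfolding vderiv_rad_square[OF x]
    by (simp add: commutator_def vec_eq_iff r2_times_def Div_Lie2[OF sG skew x] algebra_simps)
qed

text \<open>
  The zeroth-order term \<open>\<lambda>\<close> of \<open>covD_hat\<close> has two effects: \<open>2 \<partial>\<^sup>\<nu>\<lambda> D\<^sub>\<nu>f\<close> cancels the \<open>\<box>Z\<close> term, and
  it raises the multiple of \<open>\<box>\<^sub>A f\<close> from \<open>2 \<lambda>\<close> to \<open>3 \<lambda>\<close>. On the other side the same \<open>3 \<lambda>\<close>
  arises as \<open>2 \<lambda>\<close> from \<open>Z(r\<^sup>2)\<close> plus \<open>\<lambda>\<close> from \<open>covD_hat\<close>, so only the curvature terms survive.
\<close>

lemma commutator_covBox_covD_hat:
  assumes A: "\<And>\<nu>. smooth_on off_axis (\<lambda>y. A y $ \<nu>)"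
    and f: "smooth_on off_axis f" and x: "x \<in> off_axis"
  shows "commutator (r2_times (covBox A)) (covD_hat A Z) (covD_hat A Z) f x =
      2 * \<i> * of_real ((rad x)\<^sup>2) *
        (\<Sum>\<mu>\<in>UNIV. \<Sum>\<nu>\<in>UNIV. of_real (ext_d1 A x $ \<mu> $ \<nu> * Z x $ \<nu>) * covD_up A \<mu> f x)
      + \<i> * of_real ((rad x)\<^sup>2) *
        of_real (div1 (\<lambda>y. \<chi> \<mu>. \<Sum>\<nu>\<in>UNIV. Z y $ \<nu> * ext_d1 A y $ \<mu> $ \<nu>) x) * f x"
proof -
  interpret conformal_killing_gauge off_axis Z lam A
    by unfold_locales (rule A)
  define r2 where "r2 y = (rad y)\<^sup>2" for y
  have r2: "smooth_on off_axis r2" unfolding r2_def[abs_def] by (rule smooth_rad_square)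
  have sB: "smooth_on off_axis (covBox A f)"
    unfolding covBox_eq[abs_def]
    by (intro smooth_sum smooth_mult smooth_const smooth_covD f)
  have "covBox A (covD_hat A Z f) x = covBox A (\<lambda>y. covD_along A Z f y + of_real (lam y) * f y) x"
    by (rule covBox_cong[OF x covD_hat_eq])
  also have "\<dots> = covBox A (covD_along A Z f) x + covBox A (\<lambda>y. of_real (lam y) * f y) x"
    by (intro covBox_add smooth_covD_along smooth_Z smooth_mult smooth_of_real smooth_lam f x)
  finally have box: "covBox A (covD_hat A Z f) x
    = covD_along A Z (covBox A f) x + 3 * of_real (lam x) * covBox A f x
    + 2 * \<i> * (\<Sum>\<mu>\<in>UNIV. \<Sum>\<nu>\<in>UNIV. of_real (ext_d1 A x $ \<mu> $ \<nu> * Z x $ \<nu>) * covD_up A \<mu> f x)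
    + \<i> * of_real (div1 (\<lambda>y. \<chi> \<mu>. \<Sum>\<nu>\<in>UNIV. Z y $ \<nu> * ext_d1 A y $ \<mu> $ \<nu>) x) * f x"
    by (simp only: covBox_covD_along[OF f x] covBox_real_mult[OF smooth_lam f x] wave_lam[OF x])
      (simp add: algebra_simps)
  have "covD_along A Z (\<lambda>y. of_real (r2 y) * covBox A f y) x
    = of_real (r2 x) * covD_along A Z (covBox A f) x
      + of_real (\<Sum>\<mu>\<in>UNIV. Z x $ \<mu> * partial \<mu> r2 x) * covBox A f x"
    by (simp add: covD_along_def covD_real_mult[OF r2 sB x]
        sum.distrib sum_distrib_left sum_distrib_right algebra_simps)
  also have "(\<Sum>\<mu>\<in>UNIV. Z x $ \<mu> * partial \<mu> r2 x) = 2 * lam x * r2 x"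
    using vderiv_rad_square[OF x] by (simp add: r2_def[abs_def])
  finally have "covD_hat A Z (\<lambda>y. of_real (r2 y) * covBox A f y) x
    = of_real (r2 x) * (covD_along A Z (covBox A f) x + 3 * of_real (lam x) * covBox A f x)"
    by (simp add: covD_hat_eq[OF x] algebra_simps)
  then show ?thesis
    unfolding commutator_def r2_times_def[abs_def] box scaleR_conv_of_real r2_def[symmetric]
    by (simp add: algebra_simps)
qed

end

theorem lemma2p1:
  fixes A :: "spacetime \<Rightarrow> real^4"
    and F :: "spacetime \<Rightarrow> real^4^4"
    and Z :: "spacetime \<Rightarrow> real^4"
  assumes "smooth_on UNIV A"
    and "F = ext_d1 A"
    and "Z \<in> commuting_fields"
  shows "(\<forall>G. closed_two_form_on off_axis G \<longrightarrow>
            (\<forall>x\<in>off_axis. commutator (r2_times Div) (Lie2 Z) (Lie1 Z) G x = 0)) \<and>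
         (\<forall>f :: spacetime \<Rightarrow> complex. smooth_on off_axis f \<longrightarrow>
            (\<forall>x\<in>off_axis.
               commutator (r2_times (covBox A)) (covD_hat A Z) (covD_hat A Z) f x =
                 2 * \<i> * of_real ((rad x)\<^sup>2) *
                   (\<Sum>\<mu>\<in>UNIV. \<Sum>\<nu>\<in>UNIV. of_real (F x $ \<mu> $ \<nu> * Z x $ \<nu>) * covD_up A \<mu> f x)
                 + \<i> * of_real ((rad x)\<^sup>2) *
                   of_real (div1 (\<lambda>y. \<chi> \<mu>. \<Sum>\<nu>\<in>UNIV. Z y $ \<nu> * F y $ \<mu> $ \<nu>) x) * f x))"
proof -
  obtain lam where "commuting_field Z lam"
    using assms(3) by (rule commuting_fields_commuting)
  then interpret commuting_field Z lam .
  have A: "smooth_on off_axis (\<lambda>y. A y $ \<nu>)" for \<nu>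
    by (intro off_axis.smooth_component smooth_on_subset[OF assms(1)]) simp
  show ?thesis
    unfolding assms(2) using commutator_Div_Lie commutator_covBox_covD_hat[OF A]
    by (auto simp only: closed_two_form_on_def)
qed

end
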